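(* Let $d\ge 1$ be an integer, $a\in\mathbb F\setminus\{0,1\}$, and consider the evaluation module $V_d(a)$ for $\boxtimes$. Let $i,j,k,\ell\in\mathbb I$ be mutually distinct, let $\alpha$ be the $(i,j,k,\ell)$-relative of $a$, and let $r,s\in\mathbb I$ be distinct. The matrix that represents $x_{rs}$ with respect to an $[i,j,k,\ell]$-basis for $V_d(a)$ is tridiagonal, with entries as follows (rows and columns indexed by $0,\dots,d$; the $(n,n)$-entries are for $0\le n\le d$, the $(n,n-1)$- and $(n-1,n)$-entries for $1\le n\le d$; all entries not displayed are zero): - $x_{\ell k}$: $(n,n-1)$-entry $0$; $(n,n)$-entry $d-2n$; $(n-1,n)$-entry $0$. - $x_{k\ell}$: $0$; $2n-d$; $0$. - $x_{ki}$: $0$; $2n-d$; $2d-2n+2$. - $x_{ik}$: $0$; $d-2n$; $2n-2d-2$. - $x_{i\ell}$: $-2n$; $2n-d$; $0$. - $x_{\ell i}$: $2n$; $d-2n$; $0$. - $x_{\ell j}$: $2\alpha n$; $d-2n$; $0$. - $x_{j\ell}$: $-2\alpha n$; $2n-d$; $0$. - $x_{jk}$: $0$; $d-2n$; $2(n-d-1)\alpha^{-1}$. - $x_{kj}$: $0$; $2n-d$; $2(d-n+1)\alpha^{-1}$. - $x_{ji}$: $2\alpha n(\alpha-1)^{-1}$; $(d-2n)(\alpha+1)(\alpha-1)^{-1}$; $2(d-n+1)(1-\alpha)^{-1}$. - $x_{ij}$: $2\alpha n(1-\alpha)^{-1}$; $(d-2n)(\alpha+1)(1-\alpha)^{-1}$;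 $2(d-n+1)(\alpha-1)^{-1}$. (In each line the three expressions are, in order, the $(n,n-1)$-entry, the $(n,n)$-entry and the $(n-1,n)$-entry.)
   Context: $\mathbb F$ is an algebraically closed field of characteristic $0$, and $\mathbb I=\{0,1,2,3\}$. The tetrahedron algebra $\boxtimes$ is the Lie algebra over $\mathbb F$ with generators $\{x_{ij}\mid i,j\in\mathbb I,\ i\ne j\}$ and relations: (i) $x_{ij}+x_{ji}=0$ for distinct $i,j$; (ii) $[x_{ij},x_{jk}]=2x_{ij}+2x_{jk}$ for mutually distinct $i,j,k$; (iii) $[x_{ij},[x_{ij},[x_{ij},x_{k\ell}]]]=4[x_{ij},x_{k\ell}]$ for mutually distinct $i,j,k,\ell$. Evaluation modules: let $\mathfrak{sl}_2=\mathfrak{sl}_2(\mathbb F)$ with basis $e,f,h$, $[h,e]=2e$, $[h,f]=-2f$, $[e,f]=h$. Put $x=2e-h$, $y=-2f-h$, $z=h$. For $a\in\mathbb F\setminus\{0,1\}$ let $EV_a:\boxtimes\to\mathfrak{sl}_2$ be the (surjective) Lie algebra homomorphism with $x_{12}\mapsto x$, $x_{23}\mapsto y$, $x_{31}\mapsto z$, $x_{03}\mapsto ay+(a-1)z$, $x_{01}\mapsto(1-a^{-1})z-a^{-1}x$, $x_{02}\mapsto(1-a)^{-1}x+a(1-a)^{-1}y$. For $d\ge0$ let $V_d$ be the irreducible $\mathfrak{sl}_2$-module of dimension $d+1$. For $d\ge1$, $V_d(a)$ is the (irreducible) $\boxtimes$-module obtained from $V_d$ by pulling back the action via $EV_a$.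 On $V_d(a)$ each $x_{ij}$ is diagonalizable with eigenvalues $2n-d$ ($0\le n\le d$), each eigenspace having dimension $1$. Decompositions and flags of $V=V_d(a)$: for distinct $k,\ell\in\mathbb I$, component $n$ ($0\le n\le d$) of the decomposition $[k,\ell]$ is the eigenspace of $x_{k\ell}$ for eigenvalue $2n-d$. For $i\in\mathbb I$, component $n$ of the flag $[i]$ is the sum of components $0,1,\dots,n$ of the decomposition $[i,j]$, for any $j\ne i$ (this is known to be independent of $j$); in particular component $0$ of $[i]$ is the eigenspace of $x_{ij}$ with eigenvalue $-d$. For mutually distinct $i,j,k,\ell$, a basis $\{u_n\}_{n=0}^d$ of $V$ is an $[i,j,k,\ell]$-basis if (i) $u_n$ is in component $n$ of the decomposition $[k,\ell]$ for $0\le n\le d$, and (ii) $\sum_{n=0}^d u_n$ is in component $0$ of the flag $[i]$. (Such a basis exists and is unique up to multiplying all $u_n$ by a common nonzero scalar.) The matrix $X$ representing a linear map $A:V\to V$ with respect to a basis $\{u_n\}_{n=0}^d$ is defined by $Au_q=\sum_{p=0}^d X_{pq}u_p$ for $0\le q\le d$. Relatives: $S_4$, the group of permutations of $\mathbb I$ (products composed right to left), acts on $\mathbb F\setminus\{0,1\}$ by the unique action in which the transpositions $(2,0)$, $(0,1)$, $(1,3)$ send $a\mapsto a^{-1}$, $a\mapsto a(a-1)^{-1}$, $a\mapsto a^{-1}$ respectively. The $(i,j,k,\ell)$-relative of $a$ is $\sigma(a)$, where $\sigma\in S_4$ satisfies $\sigma(i)=2$, $\sigma(j)=0$, $\sigma(k)=1$,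 $\sigma(\ell)=3$. *)

theory Defs
  imports "HOL-Analysis.Analysis" "HOL-Algebra.Group_Action"
    "HOL-Computational_Algebra.Polynomial"
begin

section \<open>Lie algebras and modules\<close>

locale lie_algebra = vector_space scale
  for scale :: "'f::field \<Rightarrow> 'l::ab_group_add \<Rightarrow> 'l" +
  fixes bracket :: "'l \<Rightarrow> 'l \<Rightarrow> 'l"
  assumes bracket_linear_left: "Vector_Spaces.linear scale scale (\<lambda>x. bracket x y)"
    and bracket_linear_right: "Vector_Spaces.linear scale scale (bracket x)"
    and bracket_self: "bracket x x = 0"
    and jacobi: "bracket x (bracket y z) + bracket y (bracket z x) + bracket z (bracket x y) = 0"

locale lie_hom =
  dom: lie_algebra s1 br1 + cod: lie_algebra s2 br2 + Vector_Spaces.linear s1 s2 \<phi>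
  for s1 :: "'f::field \<Rightarrow> 'k::ab_group_add \<Rightarrow> 'k" and br1
    and s2 :: "'f \<Rightarrow> 'l::ab_group_add \<Rightarrow> 'l" and br2
    and \<phi> :: "'k \<Rightarrow> 'l" +
  assumes hom_bracket: "\<phi> (br1 x y) = br2 (\<phi> x) (\<phi> y)"

locale lie_module =
  lie: lie_algebra sL br + vec: vector_space sV
  for sL :: "'f::field \<Rightarrow> 'l::ab_group_add \<Rightarrow> 'l" and br
    and sV :: "'f \<Rightarrow> 'v::ab_group_add \<Rightarrow> 'v" +
  fixes act :: "'l \<Rightarrow> 'v \<Rightarrow> 'v"
  assumes act_linear: "Vector_Spaces.linear sV sV (act x)"
    and act_linear_left: "Vector_Spaces.linear sL sV (\<lambda>x. act x v)"
    and act_bracket: "act (br x y) v = act x (act y v) - act y (act x v)"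

locale irreducible_lie_module = lie_module sL br sV act
  for sL :: "'f::field \<Rightarrow> 'l::ab_group_add \<Rightarrow> 'l" and br
    and sV :: "'f \<Rightarrow> 'v::ab_group_add \<Rightarrow> 'v" and act +
  assumes nontrivial: "\<exists>v::'v. v \<noteq> 0"
    and irreducible: "\<lbrakk>vec.subspace W; \<And>x w. w \<in> W \<Longrightarrow> act x w \<in> W\<rbrakk> \<Longrightarrow> W = {0} \<or> W = UNIV"

definition pullback :: "('k \<Rightarrow> 'l) \<Rightarrow> ('l \<Rightarrow> 'v \<Rightarrow> 'v) \<Rightarrow> 'k \<Rightarrow> 'v \<Rightarrow> 'v" where
  "pullback \<phi> act = (\<lambda>x. act (\<phi> x))"

lemma lie_module_pullback:
  assumes "lie_hom s1 br1 s2 br2 \<phi>" "lie_module s2 br2 sV act"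
  shows "lie_module s1 br1 sV (pullback \<phi> act)"
proof -
  interpret h: lie_hom s1 br1 s2 br2 \<phi> by fact
  interpret m: lie_module s2 br2 sV act by fact
  have 1: "Vector_Spaces.linear s1 sV (\<lambda>x. act (\<phi> x) v)" for v
    using Vector_Spaces.linear_compose[OF h.linear_axioms m.act_linear_left[of v]]
    by (simp add: o_def)
  show ?thesis
    using h.dom.lie_algebra_axioms m.vec.vector_space_axioms 1 m.act_linear
    by (simp add: lie_module_def lie_module_axioms_def pullback_def h.hom_bracket m.act_bracket)
qed


section \<open>The tetrahedron algebra\<close>

text \<open>
  The index set is the type \<open>4\<close> of integers modulo 4, whose elements are \<open>0, 1, 2, 3\<close>.
  The algebra is the quotient of the formal Lie expressions in the generators by the least
  congruence containing the axioms of a Lie algebra over the field and the defining relations.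
  The negative of an expression is \<open>T_scale (- 1)\<close> of it.
\<close>

datatype 'f tet_term =
    T_gen 4 4
  | T_zero
  | T_add "'f tet_term" "'f tet_term"
  | T_scale 'f "'f tet_term"
  | T_bracket "'f tet_term" "'f tet_term"

inductive tet_eq :: "'f::field tet_term \<Rightarrow> 'f tet_term \<Rightarrow> bool" where
  refl: "tet_eq s s"
| sym: "tet_eq s t \<Longrightarrow> tet_eq t s"
| trans: "tet_eq s t \<Longrightarrow> tet_eq t u \<Longrightarrow> tet_eq s u"
| add_cong: "tet_eq s s' \<Longrightarrow> tet_eq t t' \<Longrightarrow> tet_eq (T_add s t) (T_add s' t')"
| scale_cong: "tet_eq s s' \<Longrightarrow> tet_eq (T_scale c s) (T_scale c s')"
| bracket_cong: "tet_eq s s' \<Longrightarrow> tet_eq t t' \<Longrightarrow> tet_eq (T_bracket s t) (T_bracket s' t')"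
| add_assoc: "tet_eq (T_add (T_add s t) u) (T_add s (T_add t u))"
| add_commute: "tet_eq (T_add s t) (T_add t s)"
| add_zero: "tet_eq (T_add T_zero s) s"
| add_neg: "tet_eq (T_add (T_scale (- 1) s) s) T_zero"
| scale_add_right: "tet_eq (T_scale c (T_add s t)) (T_add (T_scale c s) (T_scale c t))"
| scale_add_left: "tet_eq (T_scale (b + c) s) (T_add (T_scale b s) (T_scale c s))"
| scale_scale: "tet_eq (T_scale b (T_scale c s)) (T_scale (b * c) s)"
| scale_one: "tet_eq (T_scale 1 s) s"
| bracket_add_left: "tet_eq (T_bracket (T_add s t) u) (T_add (T_bracket s u) (T_bracket t u))"
| bracket_add_right: "tet_eq (T_bracket s (T_add t u)) (T_add (T_bracket s t) (T_bracket s u))"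
| bracket_scale_left: "tet_eq (T_bracket (T_scale c s) t) (T_scale c (T_bracket s t))"
| bracket_scale_right: "tet_eq (T_bracket s (T_scale c t)) (T_scale c (T_bracket s t))"
| bracket_self: "tet_eq (T_bracket s s) T_zero"
| jacobi: "tet_eq (T_add (T_add (T_bracket s (T_bracket t u)) (T_bracket t (T_bracket u s)))
              (T_bracket u (T_bracket s t))) T_zero"
| gen_diag: "tet_eq (T_gen i i) T_zero"
  \<comment> \<open>there is no generator with equal indices: this removes the superfluous symbol\<close>
| rel_i: "i \<noteq> j \<Longrightarrow> tet_eq (T_add (T_gen i j) (T_gen j i)) T_zero"
| rel_ii: "distinct [i, j, k] \<Longrightarrow>
    tet_eq (T_bracket (T_gen i j) (T_gen j k)) (T_add (T_scale 2 (T_gen i j)) (T_scale 2 (T_gen j k)))"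
| rel_iii: "distinct [i, j, k, l] \<Longrightarrow>
    tet_eq (T_bracket (T_gen i j) (T_bracket (T_gen i j) (T_bracket (T_gen i j) (T_gen k l))))
      (T_scale 4 (T_bracket (T_gen i j) (T_gen k l)))"

quotient_type (overloaded) 'f tet = "'f::field tet_term" / tet_eq
  proof (intro equivpI reflpI sympI transpI)
  fix s t u :: "'f tet_term"
  show "tet_eq s s" by (rule tet_eq.refl)
  show "tet_eq s t \<Longrightarrow> tet_eq t s" by (rule tet_eq.sym)
  show "tet_eq s t \<Longrightarrow> tet_eq t u \<Longrightarrow> tet_eq s u" by (rule tet_eq.trans)
qed

lift_definition tet_gen :: "4 \<Rightarrow> 4 \<Rightarrow> 'f::field tet" is T_gen .
lift_definition tet_scale :: "'f::field \<Rightarrow> 'f tet \<Rightarrow> 'f tet" is T_scale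
  by (rule tet_eq.scale_cong)
lift_definition tet_bracket :: "'f::field tet \<Rightarrow> 'f tet \<Rightarrow> 'f tet" is T_bracket
  by (rule tet_eq.bracket_cong)

instantiation tet :: (field) ab_group_add
begin
lift_definition zero_tet :: "'a tet" is T_zero .
lift_definition plus_tet :: "'a tet \<Rightarrow> 'a tet \<Rightarrow> 'a tet" is T_add by (rule tet_eq.add_cong)
lift_definition uminus_tet :: "'a tet \<Rightarrow> 'a tet" is "T_scale (- 1)" by (rule tet_eq.scale_cong)
definition minus_tet :: "'a tet \<Rightarrow> 'a tet \<Rightarrow> 'a tet" where "minus_tet x y = x + - y"
instance
proof
  fix a b c :: "'a tet"
  show "a + b + c = a + (b + c)" by transfer (rule tet_eq.add_assoc)
  show "a + b = b + a" by transfer (rule tet_eq.add_commute)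
  show "0 + a = a" by transfer (rule tet_eq.add_zero)
  show "- a + a = 0" by transfer (rule tet_eq.add_neg)
  show "a - b = a + - b" by (rule minus_tet_def)
qed
end

lemma vector_space_tet: "vector_space (tet_scale :: 'f::field \<Rightarrow> _)"
proof
  fix a b :: 'f and x y :: "'f tet"
  show "tet_scale a (x + y) = tet_scale a x + tet_scale a y"
    by transfer (rule tet_eq.scale_add_right)
  show "tet_scale (a + b) x = tet_scale a x + tet_scale b x"
    by transfer (rule tet_eq.scale_add_left)
  show "tet_scale a (tet_scale b x) = tet_scale (a * b) x"
    by transfer (rule tet_eq.scale_scale)
  show "tet_scale 1 x = x" by transfer (rule tet_eq.scale_one)
qed

lemma lie_algebra_tet: "lie_algebra (tet_scale :: 'f::field \<Rightarrow> _) tet_bracket"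
proof -
  note v = vector_space_tet[where 'f = 'f]
  have 1: "Vector_Spaces.linear tet_scale tet_scale (\<lambda>x::'f tet. tet_bracket x y)" for y
    unfolding Vector_Spaces.linear_iff
  proof (intro conjI allI v)
    fix b c :: "'f tet" and r :: 'f
    show "tet_bracket (b + c) y = tet_bracket b y + tet_bracket c y"
      by transfer (rule tet_eq.bracket_add_left)
    show "tet_bracket (tet_scale r b) y = tet_scale r (tet_bracket b y)"
      by transfer (rule tet_eq.bracket_scale_left)
  qed
  have 2: "Vector_Spaces.linear tet_scale tet_scale (tet_bracket (x::'f tet))" for x
    unfolding Vector_Spaces.linear_iff
  proof (intro conjI allI v)
    fix b c :: "'f tet" and r :: 'f
    show "tet_bracket x (b + c) = tet_bracket x b + tet_bracket x c"
      by transfer (rule tet_eq.bracket_add_right)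
    show "tet_bracket x (tet_scale r b) = tet_scale r (tet_bracket x b)"
      by transfer (rule tet_eq.bracket_scale_right)
  qed
  have 3: "tet_bracket x x = 0" for x :: "'f tet" by transfer (rule tet_eq.bracket_self)
  have 4: "tet_bracket x (tet_bracket y z) + tet_bracket y (tet_bracket z x)
      + tet_bracket z (tet_bracket x y) = 0" for x y z :: "'f tet"
    by transfer (rule tet_eq.jacobi)
  show ?thesis by (intro lie_algebra.intro lie_algebra_axioms.intro v 1 2 3 4)
qed


section \<open>The Lie algebra \<open>sl\<^sub>2\<close>\<close>

typedef (overloaded) 'f sl2 = "{A :: 'f::field^2^2. trace A = 0}"
  by (rule exI[of _ 0]) (simp add: trace_def)

setup_lifting type_definition_sl2

instantiation sl2 :: (field) ab_group_add
begin
lift_definition zero_sl2 :: "'a sl2" is 0 by (simp add: trace_def)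
lift_definition plus_sl2 :: "'a sl2 \<Rightarrow> 'a sl2 \<Rightarrow> 'a sl2" is "(+)" by (simp add: trace_add)
lift_definition uminus_sl2 :: "'a sl2 \<Rightarrow> 'a sl2" is uminus
  by (simp add: trace_def sum_negf)
lift_definition minus_sl2 :: "'a sl2 \<Rightarrow> 'a sl2 \<Rightarrow> 'a sl2" is "(-)" by (simp add: trace_sub)
instance
proof
  fix a b c :: "'a sl2"
  show "a + b + c = a + (b + c)" by transfer (rule add.assoc)
  show "a + b = b + a" by transfer (rule add.commute)
  show "0 + a = a" by transfer (rule add_0)
  show "- a + a = 0" by transfer (rule left_minus)
  show "a - b = a + - b" by transfer (rule diff_conv_add_uminus)
qed
end

lift_definition sl2_scale :: "'f::field \<Rightarrow> 'f sl2 \<Rightarrow> 'f sl2" is "\<lambda>c A. \<chi> i j. c * A $ i $ j"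
  by (simp add: trace_def sum_2 flip: distrib_left)

lift_definition sl2_bracket :: "'f::field sl2 \<Rightarrow> 'f sl2 \<Rightarrow> 'f sl2" is "\<lambda>A B. A ** B - B ** A"
  by (simp add: trace_def sum_2 matrix_matrix_mult_def mult.commute)

lift_definition sl2_e :: "'f::field sl2" is "vector [vector [0, 1], vector [0, 0]]"
  by (simp add: trace_def sum_2)
lift_definition sl2_f :: "'f::field sl2" is "vector [vector [0, 0], vector [1, 0]]"
  by (simp add: trace_def sum_2)
lift_definition sl2_h :: "'f::field sl2" is "vector [vector [1, 0], vector [0, - 1]]"
  by (simp add: trace_def sum_2)

text \<open>Coordinates with respect to \<open>h, e, f\<close>; auxiliary to the proofs below.\<close>

lift_definition sl2_mk :: "'f::field \<Rightarrow> 'f \<Rightarrow> 'f \<Rightarrow> 'f sl2"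
  is "\<lambda>p q r. vector [vector [p, q], vector [r, - p]]"
  by (simp add: trace_def sum_2)

lemmas mat2_simps = vec_eq_iff forall_2 matrix_matrix_mult_def sum_2 trace_def

lemma sl2_mk_cases [cases type]: obtains p q r where "x = sl2_mk p q r"
proof -
  have "\<exists>p q r. x = sl2_mk p q r"
  proof transfer
    fix A :: "'a^2^2" assume "trace A = 0"
    then have "A $ 2 $ 2 = - A $ 1 $ 1"
      by (simp add: trace_def sum_2 eq_neg_iff_add_eq_0 add.commute)
    then have "A = vector [vector [A $ 1 $ 1, A $ 1 $ 2], vector [A $ 2 $ 1, - A $ 1 $ 1]]"
      by (simp add: vec_eq_iff forall_2)
    then show "\<exists>p q r. A = vector [vector [p, q], vector [r, - p]]" by blast
  qed
  then show ?thesis using that by blast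
qed

lemma sl2_mk_eq_iff [simp]: "sl2_mk p q r = sl2_mk p' q' r' \<longleftrightarrow> p = p' \<and> q = q' \<and> r = r'"
  by transfer (auto simp: vec_eq_iff forall_2)

lemma sl2_mk_simps [simp]:
  "sl2_mk p q r + sl2_mk p' q' r' = sl2_mk (p + p') (q + q') (r + r')"
  "sl2_mk p q r - sl2_mk p' q' r' = sl2_mk (p - p') (q - q') (r - r')"
  "- sl2_mk p q r = sl2_mk (- p) (- q) (- r)"
  "sl2_scale c (sl2_mk p q r) = sl2_mk (c * p) (c * q) (c * r)"
  by (transfer; simp add: vec_eq_iff forall_2)+

lemma sl2_mk_bracket [simp]:
  "sl2_bracket (sl2_mk p q r) (sl2_mk p' q' r') =
     sl2_mk (q * r' - q' * r) (2 * (p * q' - q * p')) (2 * (r * p' - p * r'))"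
  by transfer (simp add: mat2_simps algebra_simps)

lemma sl2_eq_mk:
  "0 = sl2_mk 0 0 0" "sl2_e = sl2_mk 0 1 0" "sl2_f = sl2_mk 0 0 1" "sl2_h = sl2_mk 1 0 0"
  by (transfer; simp add: vec_eq_iff forall_2)+

lemma sl2_relations:
  "sl2_bracket sl2_h sl2_e = sl2_scale 2 sl2_e"
  "sl2_bracket sl2_h sl2_f = sl2_scale (- 2) sl2_f"
  "sl2_bracket sl2_e sl2_f = sl2_h"
  by (simp_all add: sl2_eq_mk)

lemma vector_space_sl2: "vector_space (sl2_scale :: 'f::field \<Rightarrow> _)"
proof
  fix a b :: 'f and x y :: "'f sl2"
  obtain p q r p' q' r' where xy: "x = sl2_mk p q r" "y = sl2_mk p' q' r'"
    by (metis sl2_mk_cases)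
  show "sl2_scale a (x + y) = sl2_scale a x + sl2_scale a y"
    "sl2_scale (a + b) x = sl2_scale a x + sl2_scale b x"
    "sl2_scale a (sl2_scale b x) = sl2_scale (a * b) x"
    "sl2_scale 1 x = x"
    by (simp_all add: xy algebra_simps)
qed

lemma lie_algebra_sl2: "lie_algebra (sl2_scale :: 'f::field \<Rightarrow> _) sl2_bracket"
proof -
  note v = vector_space_sl2[where 'f = 'f]
  have 1: "Vector_Spaces.linear sl2_scale sl2_scale (\<lambda>x::'f sl2. sl2_bracket x y)" for y
    unfolding Vector_Spaces.linear_iff
  proof (intro conjI allI v)
    fix b c :: "'f sl2" and r :: 'f
    show "sl2_bracket (b + c) y = sl2_bracket b y + sl2_bracket c y"
      by (cases b, cases c, cases y) (simp add: algebra_simps)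
    show "sl2_bracket (sl2_scale r b) y = sl2_scale r (sl2_bracket b y)"
      by (cases b, cases y) (simp add: algebra_simps)
  qed
  have 2: "Vector_Spaces.linear sl2_scale sl2_scale (sl2_bracket (x::'f sl2))" for x
    unfolding Vector_Spaces.linear_iff
  proof (intro conjI allI v)
    fix b c :: "'f sl2" and r :: 'f
    show "sl2_bracket x (b + c) = sl2_bracket x b + sl2_bracket x c"
      by (cases b, cases c, cases x) (simp add: algebra_simps)
    show "sl2_bracket x (sl2_scale r b) = sl2_scale r (sl2_bracket x b)"
      by (cases b, cases x) (simp add: algebra_simps)
  qed
  have 3: "sl2_bracket x x = 0" for x :: "'f sl2"
    by (cases x) (simp add: sl2_eq_mk)
  have 4: "sl2_bracket x (sl2_bracket y z) + sl2_bracket y (sl2_bracket z x)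
      + sl2_bracket z (sl2_bracket x y) = 0" for x y z :: "'f sl2"
    by (cases x, cases y, cases z) (simp add: sl2_eq_mk algebra_simps)
  show ?thesis by (intro lie_algebra.intro lie_algebra_axioms.intro v 1 2 3 4)
qed

definition sl2_x :: "'f::field sl2" where "sl2_x = sl2_scale 2 sl2_e - sl2_h"
definition sl2_y :: "'f::field sl2" where "sl2_y = sl2_scale (- 2) sl2_f - sl2_h"
definition sl2_z :: "'f::field sl2" where "sl2_z = sl2_h"


section \<open>Evaluation modules\<close>

definition is_EV :: "'f::field \<Rightarrow> ('f tet \<Rightarrow> 'f sl2) \<Rightarrow> bool" where
  "is_EV a \<phi> \<longleftrightarrow> lie_hom tet_scale tet_bracket sl2_scale sl2_bracket \<phi> \<and>
     \<phi> (tet_gen 1 2) = sl2_x \<and> \<phi> (tet_gen 2 3) = sl2_y \<and> \<phi> (tet_gen 3 1) = sl2_z \<and>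
     \<phi> (tet_gen 0 3) = sl2_scale a sl2_y + sl2_scale (a - 1) sl2_z \<and>
     \<phi> (tet_gen 0 1) = sl2_scale (1 - inverse a) sl2_z - sl2_scale (inverse a) sl2_x \<and>
     \<phi> (tet_gen 0 2) = sl2_scale (inverse (1 - a)) sl2_x + sl2_scale (a * inverse (1 - a)) sl2_y"

definition EV :: "'f::field \<Rightarrow> 'f tet \<Rightarrow> 'f sl2" where
  "EV a = (THE \<phi>. is_EV a \<phi>)"

lemma lie_hom_tet_eqI:
  assumes "lie_hom tet_scale tet_bracket s br \<phi>" "lie_hom tet_scale tet_bracket s br \<psi>"
    and gen: "\<And>i j. \<phi> (tet_gen i j) = \<psi> (tet_gen i j)"
  shows "\<phi> = \<psi>"
proof
  interpret p: lie_hom tet_scale tet_bracket s br \<phi> by fact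
  interpret q: lie_hom tet_scale tet_bracket s br \<psi> by fact
  have "\<phi> (abs_tet t) = \<psi> (abs_tet t)" for t
  proof (induction t)
    case (T_gen i j)
    then show ?case using gen[of i j] by (simp add: tet_gen.abs_eq)
  next
    case T_zero
    then show ?case by (simp flip: zero_tet.abs_eq add: p.zero q.zero)
  next
    case (T_add t u)
    then show ?case by (simp flip: plus_tet.abs_eq add: p.add q.add)
  next
    case (T_scale c t)
    then show ?case by (simp flip: tet_scale.abs_eq add: p.scale q.scale)
  next
    case (T_bracket t u)
    then show ?case by (simp flip: tet_bracket.abs_eq add: p.hom_bracket q.hom_bracket)
  qed
  then show "\<phi> x = \<psi> x" for x by (induction x rule: tet.abs_induct) simp
qed

lemma tet_gen_swap: "tet_gen j i = - (tet_gen i j :: 'f::field tet)"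
proof (cases "i = j")
  case True
  have "tet_gen i i = (0 :: 'f tet)" by transfer (rule tet_eq.gen_diag)
  with True show ?thesis by simp
next
  case False
  have "tet_gen i j + tet_gen j i = (0 :: 'f tet)" using False by transfer (rule tet_eq.rel_i)
  then show ?thesis by (metis neg_eq_iff_add_eq_0)
qed

definition ev_half :: "'f::field \<Rightarrow> 4 \<Rightarrow> 4 \<Rightarrow> 'f sl2" where
  "ev_half a i j =
    (if i = 1 \<and> j = 2 then sl2_x else if i = 2 \<and> j = 3 then sl2_y
     else if i = 3 \<and> j = 1 then sl2_z
     else if i = 0 \<and> j = 3 then sl2_scale a sl2_y + sl2_scale (a - 1) sl2_z
     else if i = 0 \<and> j = 1 then sl2_scale (1 - inverse a) sl2_z - sl2_scale (inverse a) sl2_x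
     else if i = 0 \<and> j = 2 then
       sl2_scale (inverse (1 - a)) sl2_x + sl2_scale (a * inverse (1 - a)) sl2_y
     else 0)"

primrec ev_term :: "'f::field \<Rightarrow> 'f tet_term \<Rightarrow> 'f sl2" where
  "ev_term a (T_gen i j) = ev_half a i j - ev_half a j i"
| "ev_term a T_zero = 0"
| "ev_term a (T_add s t) = ev_term a s + ev_term a t"
| "ev_term a (T_scale c s) = sl2_scale c (ev_term a s)"
| "ev_term a (T_bracket s t) = sl2_bracket (ev_term a s) (ev_term a t)"

lemma cases_4: fixes i :: 4 obtains "i = 0" | "i = 1" | "i = 2" | "i = 3"
  using exhaust_4[of i] by auto

lemma ev_half_mk:
  fixes a :: "'f::field"
  shows "ev_half a 1 2 = sl2_mk (- 1) 2 0" "ev_half a 2 3 = sl2_mk (- 1) 0 (- 2)"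
    "ev_half a 3 1 = sl2_mk 1 0 0" "ev_half a 0 3 = sl2_mk (- 1) 0 (- 2 * a)"
    "ev_half a 0 1 = sl2_mk 1 (- 2 * inverse a) 0"
    "ev_half a 0 2 = sl2_mk (- inverse (1 - a) - a * inverse (1 - a))
       (2 * inverse (1 - a)) (- 2 * (a * inverse (1 - a)))"
    "ev_half a 2 1 = sl2_mk 0 0 0" "ev_half a 3 2 = sl2_mk 0 0 0"
    "ev_half a 1 3 = sl2_mk 0 0 0" "ev_half a 3 0 = sl2_mk 0 0 0"
    "ev_half a 1 0 = sl2_mk 0 0 0" "ev_half a 2 0 = sl2_mk 0 0 0"
  by (simp_all add: ev_half_def sl2_x_def sl2_y_def sl2_z_def sl2_eq_mk)

lemma sl2_cube:
  fixes p q r :: "'f::field"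
  assumes "p * p + q * r = 1" and X: "X = sl2_mk p q r"
  shows "sl2_bracket X (sl2_bracket X (sl2_bracket X Y)) = sl2_scale 4 (sl2_bracket X Y)"
proof (cases Y)
  case (1 u v w)
  have *: "sl2_bracket X (sl2_bracket X (sl2_bracket X Y)) =
      sl2_scale (4 * (p * p + q * r)) (sl2_bracket X Y)"
    unfolding X 1 by (simp add: algebra_simps)
  show ?thesis using * assms(1) by simp
qed

lemma ev_rel_ii:
  fixes a :: "'f::field"
  assumes "a \<noteq> 0" "a \<noteq> 1" "distinct [i, j, k]"
  shows "ev_term a (T_bracket (T_gen i j) (T_gen j k)) =
    ev_term a (T_add (T_scale 2 (T_gen i j)) (T_scale 2 (T_gen j k)))"
proof -
  define b where "b = inverse a"
  define c where "c = inverse (1 - a)"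
  have "1 - a \<noteq> 0" using assms by simp
  then have abc: "a * b = 1" "a * c = c - 1" "b * c = b + c"
    using assms(1) by (simp_all add: b_def c_def field_simps)
  then have abc': "a * (b * t) = t" "a * (c * t) = c * t - t" "b * (c * t) = b * t + c * t" for t
    by (metis mult.assoc mult_1 left_diff_distrib distrib_right)+
  show ?thesis
    using assms
    by (cases i rule: cases_4; cases j rule: cases_4; cases k rule: cases_4)
       (simp_all add: ev_half_mk flip: b_def c_def, simp_all add: algebra_simps abc abc')
qed

lemma ev_det:
  fixes a :: "'f::field"
  assumes "a \<noteq> 0" "a \<noteq> 1" "i \<noteq> j"
  shows "\<exists>p q r. ev_term a (T_gen i j) = sl2_mk p q r \<and> p * p + q * r = 1"
proof -
  define c where "c = inverse (1 - a)"
  have "1 - a \<noteq> 0" using assms by simp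
  then have "a * c = c - 1" by (simp add: c_def field_simps)
  moreover from this have "a * (c * t) = c * t - t" for t
    by (metis mult.assoc mult_1 left_diff_distrib)
  ultimately show ?thesis
    using assms
    by (cases i rule: cases_4; cases j rule: cases_4)
       (simp_all add: ev_half_mk flip: c_def, simp_all add: algebra_simps)
qed

lemma ev_term_cong:
  assumes a: "a \<noteq> 0" "a \<noteq> (1::'f::field)" and "tet_eq s t"
  shows "ev_term a s = ev_term a t"
proof -
  interpret lie_algebra "sl2_scale :: 'f \<Rightarrow> _" sl2_bracket by (rule lie_algebra_sl2)
  show ?thesis
    using assms(3)
  proof induction
    case (rel_ii i j k)
    then show ?case by (rule ev_rel_ii[OF a])
  next
    case (rel_iii i j k l)
    then have "i \<noteq> j" by simp
    from ev_det[OF a this] obtain p q r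
      where "ev_term a (T_gen i j) = sl2_mk p q r" "p * p + q * r = 1" by blast
    then show ?case unfolding ev_term.simps by (intro sl2_cube)
  next
    case (jacobi s t u)
    then show ?case using lie_algebra.jacobi[OF lie_algebra_sl2] by simp
  qed (simp_all add: scale_right_distrib scale_left_distrib bracket_self
      Vector_Spaces.linear_iff[THEN iffD1, OF bracket_linear_left] Vector_Spaces.linear_iff[THEN iffD1, OF bracket_linear_right])
qed

theorem EV_ex1:
  assumes a: "a \<noteq> 0" "a \<noteq> (1::'f::field)"
  shows "\<exists>!\<phi>. is_EV a \<phi>"
proof -
  define \<phi> where "\<phi> x = ev_term a (rep_tet x)" for x
  have \<phi>: "\<phi> (abs_tet t) = ev_term a t" for t
    unfolding \<phi>_def
  proof (rule ev_term_cong[OF a])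
    show "tet_eq (rep_tet (abs_tet t)) t"
      unfolding tet.abs_eq_iff[symmetric] by (rule Quotient3_abs_rep[OF Quotient3_tet])
  qed
  have 1: "\<phi> (x + y) = \<phi> x + \<phi> y" for x y
    by (induction x rule: tet.abs_induct, induction y rule: tet.abs_induct)
       (simp add: plus_tet.abs_eq \<phi>)
  have 2: "\<phi> (tet_scale c x) = sl2_scale c (\<phi> x)" for c x
    by (induction x rule: tet.abs_induct) (simp add: tet_scale.abs_eq \<phi>)
  have 3: "\<phi> (tet_bracket x y) = sl2_bracket (\<phi> x) (\<phi> y)" for x y
    by (induction x rule: tet.abs_induct, induction y rule: tet.abs_induct)
       (simp add: tet_bracket.abs_eq \<phi>)
  have "Vector_Spaces.linear tet_scale sl2_scale \<phi>"
    unfolding Vector_Spaces.linear_iff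
    by (intro conjI allI vector_space_tet vector_space_sl2 1 2)
  then have hom: "lie_hom tet_scale tet_bracket sl2_scale sl2_bracket \<phi>"
    by (intro lie_hom.intro lie_hom_axioms.intro lie_algebra_tet lie_algebra_sl2 3)
  have "is_EV a \<phi>"
    unfolding is_EV_def using hom
    by (simp add: tet_gen.abs_eq \<phi> ev_half_def)
  moreover have "\<phi>' = \<psi>" if "is_EV a \<phi>'" "is_EV a \<psi>" for \<phi>' \<psi> :: "'f tet \<Rightarrow> 'f sl2"
  proof (rule lie_hom_tet_eqI)
    show p: "lie_hom tet_scale tet_bracket sl2_scale sl2_bracket \<phi>'"
      and q: "lie_hom tet_scale tet_bracket sl2_scale sl2_bracket \<psi>"
      using that by (simp_all add: is_EV_def)
    interpret p: lie_hom tet_scale tet_bracket sl2_scale sl2_bracket \<phi>' by (rule p)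
    interpret q: lie_hom tet_scale tet_bracket sl2_scale sl2_bracket \<psi> by (rule q)
    have diag: "tet_gen i i = (0 :: 'f tet)" for i by transfer (rule tet_eq.gen_diag)
    have base: "\<phi>' (tet_gen i j) = \<psi> (tet_gen i j)"
      if "(i, j) \<in> {(1,2), (2,3), (3,1), (0,3), (0,1), (0,2)}" for i j
      using that \<open>is_EV a \<phi>'\<close> \<open>is_EV a \<psi>\<close> by (auto simp: is_EV_def)
    have swap: "\<phi>' (tet_gen j i) = \<psi> (tet_gen j i)" if "\<phi>' (tet_gen i j) = \<psi> (tet_gen i j)" for i j
      using that by (simp add: tet_gen_swap[of j i] p.neg q.neg)
    show "\<phi>' (tet_gen i j) = \<psi> (tet_gen i j)" for i j
      by (cases i rule: cases_4; cases j rule: cases_4; hypsubst)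
         (simp add: diag p.zero q.zero; fail | rule base, simp; fail | rule swap, rule base, simp; fail)+
  qed
  ultimately show ?thesis by blast
qed

lemma is_EV_EV: "a \<noteq> 0 \<Longrightarrow> a \<noteq> 1 \<Longrightarrow> is_EV a (EV a)"
  unfolding EV_def by (rule theI'[OF EV_ex1])

lemma lie_module_evaluation:
  assumes "a \<noteq> 0" "a \<noteq> 1" "lie_module sl2_scale sl2_bracket sV \<rho>"
  shows "lie_module tet_scale tet_bracket sV (pullback (EV a) \<rho>)"
  using is_EV_EV[OF assms(1,2)] assms(3) unfolding is_EV_def by (blast intro: lie_module_pullback)


section \<open>Decompositions, flags and bases\<close>

text \<open>
  In the following, \<open>sV\<close> is the scalar multiplication of a module and \<open>act\<close> the action of the
  tetrahedron algebra on it; these are meant for an evaluation module of dimension \<open>d + 1\<close>.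
\<close>

definition decomposition_component ::
    "('f::field \<Rightarrow> 'v::ab_group_add \<Rightarrow> 'v) \<Rightarrow> ('f tet \<Rightarrow> 'v \<Rightarrow> 'v) \<Rightarrow> nat \<Rightarrow> 4 \<Rightarrow> 4 \<Rightarrow> nat \<Rightarrow> 'v set" where
  "decomposition_component sV act d k l n =
    {v. act (tet_gen k l) v = sV (2 * of_nat n - of_nat d) v}"

text \<open>The common value, for all \<open>j \<noteq> i\<close>, of the sum of components \<open>0, \<dots>, n\<close> of \<open>[i, j]\<close>.\<close>

definition flag_component ::
    "('f::field \<Rightarrow> 'v::ab_group_add \<Rightarrow> 'v) \<Rightarrow> ('f tet \<Rightarrow> 'v \<Rightarrow> 'v) \<Rightarrow> nat \<Rightarrow> 4 \<Rightarrow> nat \<Rightarrow> 'v set" where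
  "flag_component sV act d i n =
    (THE W. \<forall>j. j \<noteq> i \<longrightarrow>
       W = {\<Sum>m\<le>n. w m | w. \<forall>m\<le>n. w m \<in> decomposition_component sV act d i j m})"

definition indexed_basis ::
    "('f::field \<Rightarrow> 'v::ab_group_add \<Rightarrow> 'v) \<Rightarrow> nat \<Rightarrow> (nat \<Rightarrow> 'v) \<Rightarrow> bool" where
  "indexed_basis sV d u \<longleftrightarrow> inj_on u {..d} \<and> \<not> module.dependent sV (u ` {..d}) \<and>
     module.span sV (u ` {..d}) = UNIV"

definition tet_basis ::
    "('f::field \<Rightarrow> 'v::ab_group_add \<Rightarrow> 'v) \<Rightarrow> ('f tet \<Rightarrow> 'v \<Rightarrow> 'v) \<Rightarrow> nat \<Rightarrow>
      4 \<Rightarrow> 4 \<Rightarrow> 4 \<Rightarrow> 4 \<Rightarrow> (nat \<Rightarrow> 'v) \<Rightarrow> bool" where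
  "tet_basis sV act d i j k l u \<longleftrightarrow>
     distinct [i, j, k, l] \<and> indexed_basis sV d u \<and>
     (\<forall>n\<le>d. u n \<in> decomposition_component sV act d k l n) \<and>
     (\<Sum>n\<le>d. u n) \<in> flag_component sV act d i 0"

definition represents ::
    "('f::field \<Rightarrow> 'v::ab_group_add \<Rightarrow> 'v) \<Rightarrow> nat \<Rightarrow> (nat \<Rightarrow> 'v) \<Rightarrow> ('v \<Rightarrow> 'v) \<Rightarrow>
      (nat \<Rightarrow> nat \<Rightarrow> 'f) \<Rightarrow> bool" where
  "represents sV d u A X \<longleftrightarrow> (\<forall>q\<le>d. A (u q) = (\<Sum>p\<le>d. sV (X p q) (u p)))"

definition tridiagonal :: "nat \<Rightarrow> (nat \<Rightarrow> nat \<Rightarrow> 'f::zero) \<Rightarrow> bool" where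
  "tridiagonal d X \<longleftrightarrow> (\<forall>p\<le>d. \<forall>q\<le>d. (p + 1 < q \<or> q + 1 < p) \<longrightarrow> X p q = 0)"

definition has_entries ::
    "nat \<Rightarrow> (nat \<Rightarrow> nat \<Rightarrow> 'f) \<Rightarrow> (nat \<Rightarrow> 'f) \<Rightarrow> (nat \<Rightarrow> 'f) \<Rightarrow> (nat \<Rightarrow> 'f) \<Rightarrow> bool" where
  "has_entries d X lo di up \<longleftrightarrow>
     (\<forall>n\<in>{1..d}. X n (n - 1) = lo n) \<and> (\<forall>n\<le>d. X n n = di n) \<and> (\<forall>n\<in>{1..d}. X (n - 1) n = up n)"


section \<open>Relatives\<close>

text \<open>
  The group \<open>S\<^sub>4\<close> is \<open>BijGroup UNIV\<close> on the index type; its product is composition, right factor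
  first. \<open>S4_act\<close> is made unique by requiring the value \<open>undefined\<close> off the carrier of the group.
\<close>

definition is_S4_action :: "((4 \<Rightarrow> 4) \<Rightarrow> 'f::field \<Rightarrow> 'f) \<Rightarrow> bool" where
  "is_S4_action \<phi> \<longleftrightarrow> group_action (BijGroup (UNIV :: 4 set)) (UNIV - {0, 1}) \<phi> \<and>
     (\<forall>a\<in>UNIV - {0, 1}.
        \<phi> (Transposition.transpose 2 0) a = inverse a \<and>
        \<phi> (Transposition.transpose 0 1) a = a * inverse (a - 1) \<and>
        \<phi> (Transposition.transpose 1 3) a = inverse a)"

definition S4_act :: "(4 \<Rightarrow> 4) \<Rightarrow> 'f::field \<Rightarrow> 'f" where
  "S4_act = (THE \<phi>. is_S4_action \<phi> \<and> \<phi> \<in> extensional (carrier (BijGroup UNIV)))"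

definition relative :: "4 \<Rightarrow> 4 \<Rightarrow> 4 \<Rightarrow> 4 \<Rightarrow> 'f::field \<Rightarrow> 'f" where
  "relative i j k l a =
     S4_act (THE \<sigma>. bij \<sigma> \<and> \<sigma> i = 2 \<and> \<sigma> j = 0 \<and> \<sigma> k = 1 \<and> \<sigma> l = 3) a"

text \<open>
  Existence of the action: \<open>a\<close> is encoded by the triple \<open>(1, - a, a - 1)\<close>, of sum zero and up to
  a common factor, whose entries belong to the three partitions of the index set into two pairs.
\<close>

definition pair_weight :: "'f::field \<Rightarrow> 4 \<Rightarrow> 4 \<Rightarrow> 'f" where
  "pair_weight a i j =
    (if {i, j} = {0, 3} \<or> {i, j} = {1, 2} then 1
     else if {i, j} = {0, 1} \<or> {i, j} = {2, 3} then - a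
     else if {i, j} = {0, 2} \<or> {i, j} = {1, 3} then a - 1 else 0)"

lemma pair_weight_simps:
  "pair_weight a i i = 0"
  "pair_weight a 0 3 = 1" "pair_weight a 3 0 = 1" "pair_weight a 1 2 = 1" "pair_weight a 2 1 = 1"
  "pair_weight a 0 1 = - a" "pair_weight a 1 0 = - a" "pair_weight a 2 3 = - a" "pair_weight a 3 2 = - a"
  "pair_weight a 0 2 = a - 1" "pair_weight a 2 0 = a - 1" "pair_weight a 1 3 = a - 1" "pair_weight a 3 1 = a - 1"
  by (auto simp: pair_weight_def doubleton_eq_iff)

lemma pair_weight_sym: "pair_weight a i j = pair_weight a j i"
  by (simp add: pair_weight_def insert_commute)

lemma pair_weight_nz: "a \<noteq> 0 \<Longrightarrow> a \<noteq> 1 \<Longrightarrow> i \<noteq> j \<Longrightarrow> pair_weight a i j \<noteq> 0"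
  by (cases i rule: cases_4; cases j rule: cases_4) (simp_all add: pair_weight_simps)

lemma pair_weight_compl:
  "distinct [p, q, r, s] \<Longrightarrow> pair_weight a p q = pair_weight a r s"
  by (cases p rule: cases_4; cases q rule: cases_4; cases r rule: cases_4; cases s rule: cases_4)
     (simp_all add: pair_weight_simps)

lemma pair_weight_sum:
  "distinct [p, q, r, s] \<Longrightarrow> pair_weight a p q + pair_weight a p r + pair_weight a p s = 0"
  by (cases p rule: cases_4; cases q rule: cases_4; cases r rule: cases_4; cases s rule: cases_4)
     (simp_all add: pair_weight_simps)

definition permuted_ratio :: "'f::field \<Rightarrow> (4 \<Rightarrow> 4) \<Rightarrow> 'f" where
  "permuted_ratio a \<tau> = - pair_weight a (\<tau> 0) (\<tau> 1) / pair_weight a (\<tau> 0) (\<tau> 3)"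

lemma permuted_ratio:
  fixes a :: "'f::field"
  assumes a: "a \<noteq> 0" "a \<noteq> 1" and "bij \<tau>"
  shows "permuted_ratio a \<tau> \<noteq> 0" "permuted_ratio a \<tau> \<noteq> 1"
    and "pair_weight (permuted_ratio a \<tau>) i j =
      pair_weight a (\<tau> i) (\<tau> j) / pair_weight a (\<tau> 0) (\<tau> 3)"
proof -
  let ?P = "\<lambda>i j. pair_weight a (\<tau> i) (\<tau> j)"
  have inj: "\<tau> i = \<tau> j \<longleftrightarrow> i = j" for i j using \<open>bij \<tau>\<close> by (auto simp: bij_def inj_eq)
  have nz: "?P i j \<noteq> 0" if "i \<noteq> j" for i j using that a by (simp add: pair_weight_nz inj)
  have sum: "?P 0 1 + ?P 0 2 + ?P 0 3 = 0" by (rule pair_weight_sum) (simp add: inj)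
  then have sum': "?P 0 2 = - ?P 0 1 - ?P 0 3" by (simp add: algebra_simps eq_neg_iff_add_eq_0)
  have compl: "?P 1 2 = ?P 0 3" "?P 2 3 = ?P 0 1" "?P 1 3 = ?P 0 2"
    by (rule pair_weight_compl, simp add: inj)+
  note sym = pair_weight_sym[of a "\<tau> 1" "\<tau> 0"] pair_weight_sym[of a "\<tau> 2" "\<tau> 0"]
    pair_weight_sym[of a "\<tau> 3" "\<tau> 0"] pair_weight_sym[of a "\<tau> 2" "\<tau> 1"]
    pair_weight_sym[of a "\<tau> 3" "\<tau> 1"] pair_weight_sym[of a "\<tau> 3" "\<tau> 2"]
  show "permuted_ratio a \<tau> \<noteq> 0" using nz by (simp add: permuted_ratio_def)
  have "?P 0 2 \<noteq> 0" "?P 0 3 \<noteq> 0" by (simp_all add: nz)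
  then show "permuted_ratio a \<tau> \<noteq> 1"
    using sum' by (auto simp: permuted_ratio_def field_simps)
  show "pair_weight (permuted_ratio a \<tau>) i j = ?P i j / ?P 0 3"
    using \<open>?P 0 3 \<noteq> 0\<close>
    by (cases i rule: cases_4; cases j rule: cases_4; hypsubst;
        simp add: pair_weight_simps sym compl sum'; simp add: permuted_ratio_def field_simps)
qed

lemma permuted_ratio_comp:
  assumes "a \<noteq> 0" "a \<noteq> (1 :: 'f::field)" "bij \<tau>"
  shows "permuted_ratio (permuted_ratio a \<tau>) \<rho> = permuted_ratio a (\<tau> \<circ> \<rho>)"
proof -
  have "pair_weight a (\<tau> 0) (\<tau> 3) \<noteq> 0"
    using assms by (intro pair_weight_nz) (auto simp: bij_def inj_eq)
  then show ?thesis
    unfolding permuted_ratio_def[of "permuted_ratio a \<tau>"] permuted_ratio(3)[OF assms]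
    by (simp add: permuted_ratio_def)
qed

lemma BijGroup_UNIV:
  "carrier (BijGroup UNIV) = {f. bij f}"
  "bij f \<Longrightarrow> bij g \<Longrightarrow> f \<otimes>\<^bsub>BijGroup UNIV\<^esub> g = f \<circ> g"
  by (auto simp: BijGroup_def Bij_def compose_def)

lemma ex_S4_action: "\<exists>\<phi> :: (4 \<Rightarrow> 4) \<Rightarrow> 'f::field \<Rightarrow> 'f. is_S4_action \<phi> \<and>
    \<phi> \<in> extensional (carrier (BijGroup UNIV))"
proof -
  define E where "E = (UNIV - {0, 1} :: 'f set)"
  define \<phi> where "\<phi> = (\<lambda>\<sigma>\<in>carrier (BijGroup (UNIV :: 4 set)). \<lambda>a\<in>E. permuted_ratio a (inv_into UNIV \<sigma>))"
  have eval: "\<phi> \<sigma> a = permuted_ratio a (inv_into UNIV \<sigma>)" if "bij \<sigma>" "a \<in> E" for \<sigma> a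
    using that by (simp add: \<phi>_def BijGroup_UNIV)
  have closed: "\<phi> \<sigma> a \<in> E" if "bij \<sigma>" "a \<in> E" for \<sigma> a
    using that permuted_ratio(1,2)[of a "inv_into UNIV \<sigma>"]
    by (simp add: eval bij_imp_bij_inv) (simp add: E_def)
  have comp: "\<phi> (\<sigma> \<circ> \<tau>) a = \<phi> \<sigma> (\<phi> \<tau> a)" if "bij \<sigma>" "bij \<tau>" "a \<in> E" for \<sigma> \<tau> a
  proof -
    have "permuted_ratio (permuted_ratio a (inv_into UNIV \<tau>)) (inv_into UNIV \<sigma>) =
        permuted_ratio a (inv_into UNIV \<tau> \<circ> inv_into UNIV \<sigma>)"
      using that by (intro permuted_ratio_comp) (auto simp: E_def bij_imp_bij_inv)
    then show ?thesis
      using that closed[OF that(2,3)] by (simp add: eval bij_comp o_inv_distrib)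
  qed
  have id: "\<phi> id a = a" if "a \<in> E" for a
    using that by (simp add: eval) (simp add: permuted_ratio_def pair_weight_simps)
  have inverse: "\<phi> \<sigma> (\<phi> (inv_into UNIV \<sigma>) a) = a" "\<phi> (inv_into UNIV \<sigma>) (\<phi> \<sigma> a) = a"
    if "bij \<sigma>" "a \<in> E" for \<sigma> a
  proof -
    have "\<sigma> \<circ> inv_into UNIV \<sigma> = id" "inv_into UNIV \<sigma> \<circ> \<sigma> = id"
      using that by (simp_all add: bij_def surj_iff)
    then show "\<phi> \<sigma> (\<phi> (inv_into UNIV \<sigma>) a) = a" "\<phi> (inv_into UNIV \<sigma>) (\<phi> \<sigma> a) = a"
      using comp[of \<sigma> "inv_into UNIV \<sigma>" a] comp[of "inv_into UNIV \<sigma>" \<sigma> a] that id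
      by (simp_all add: bij_imp_bij_inv)
  qed
  have Bij: "\<phi> \<sigma> \<in> Bij E" if "bij \<sigma>" for \<sigma>
  proof -
    have "bij_betw (\<phi> \<sigma>) E E"
      by (rule bij_betw_byWitness[of _ "\<phi> (inv_into UNIV \<sigma>)"])
         (use that closed inverse in \<open>auto simp: bij_imp_bij_inv\<close>)
    moreover have "\<phi> \<sigma> \<in> extensional E" using that by (simp add: \<phi>_def BijGroup_UNIV)
    ultimately show ?thesis by (simp add: Bij_def)
  qed
  have "\<phi> \<in> hom (BijGroup UNIV) (BijGroup E)"
  proof (rule homI)
    fix \<sigma> \<tau> :: "4 \<Rightarrow> 4"
    assume "\<sigma> \<in> carrier (BijGroup UNIV)" and "\<tau> \<in> carrier (BijGroup UNIV)"
    then have st: "bij \<sigma>" "bij \<tau>" by (simp_all add: BijGroup_UNIV)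
    show "\<phi> \<sigma> \<in> carrier (BijGroup E)" using Bij[OF st(1)] by (simp add: BijGroup_def)
    have "\<phi> (\<sigma> \<circ> \<tau>) = compose E (\<phi> \<sigma>) (\<phi> \<tau>)"
    proof (rule extensionalityI[of _ E])
      show "\<phi> (\<sigma> \<circ> \<tau>) \<in> extensional E" using Bij[OF bij_comp[OF st(2,1)]] by (simp add: Bij_def)
    qed (simp_all add: compose_eq comp st)
    then show "\<phi> (\<sigma> \<otimes>\<^bsub>BijGroup UNIV\<^esub> \<tau>) = \<phi> \<sigma> \<otimes>\<^bsub>BijGroup E\<^esub> \<phi> \<tau>"
      using Bij[OF st(1)] Bij[OF st(2)] by (simp add: BijGroup_UNIV st) (simp add: BijGroup_def)
  qed
  then have "group_action (BijGroup UNIV) E \<phi>"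
    by (intro group_action.intro group_hom.intro group_hom_axioms.intro group_BijGroup)
  moreover have "\<phi> (Transposition.transpose 2 0) a = inverse a \<and>
      \<phi> (Transposition.transpose 0 1) a = a * inverse (a - 1) \<and>
      \<phi> (Transposition.transpose 1 3) a = inverse a" if "a \<in> E" for a
    using that
    by (simp add: eval)
       (simp add: permuted_ratio_def pair_weight_simps Transposition.transpose_def divide_inverse)
  ultimately have "is_S4_action \<phi>" unfolding is_S4_action_def E_def by blast
  moreover have "\<phi> \<in> extensional (carrier (BijGroup UNIV))" by (simp add: \<phi>_def)
  ultimately show ?thesis by blast
qed

lemma S4_action_unique:
  fixes \<phi> \<psi> :: "(4 \<Rightarrow> 4) \<Rightarrow> 'f::field \<Rightarrow> 'f"
  assumes \<phi>: "is_S4_action \<phi>" and \<psi>: "is_S4_action \<psi>" and "bij \<sigma>"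
  shows "\<phi> \<sigma> = \<psi> \<sigma>"
proof -
  define E where "E = (UNIV - {0, 1} :: 'f set)"
  interpret p: group_action "BijGroup (UNIV :: 4 set)" E \<phi> using \<phi> by (simp add: is_S4_action_def E_def)
  interpret q: group_action "BijGroup (UNIV :: 4 set)" E \<psi> using \<psi> by (simp add: is_S4_action_def E_def)
  interpret p: group_hom "BijGroup (UNIV :: 4 set)" "BijGroup E" \<phi> by (rule p.group_hom)
  interpret q: group_hom "BijGroup (UNIV :: 4 set)" "BijGroup E" \<psi> by (rule q.group_hom)
  let ?T = Transposition.transpose
  have comp: "\<phi> (\<sigma> \<circ> \<tau>) = \<psi> (\<sigma> \<circ> \<tau>)"
    if "\<phi> \<sigma> = \<psi> \<sigma>" "\<phi> \<tau> = \<psi> \<tau>" "bij \<sigma>" "bij \<tau>" for \<sigma> \<tau>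
    using that p.hom_mult[of \<sigma> \<tau>] q.hom_mult[of \<sigma> \<tau>] by (simp add: BijGroup_UNIV)
  have id: "\<phi> id = \<psi> id"
    using p.hom_one q.hom_one by (simp add: BijGroup_def id_def restrict_def)
  have eq: "\<phi> \<sigma> = \<psi> \<sigma>" if "bij \<sigma>" "\<And>a. a \<in> E \<Longrightarrow> \<phi> \<sigma> a = \<psi> \<sigma> a" for \<sigma>
    using that p.bij_prop0[of \<sigma>] q.bij_prop0[of \<sigma>]
    by (intro extensionalityI[of _ E]) (auto simp: BijGroup_UNIV Bij_def)
  have gen: "\<phi> (?T 2 0) = \<psi> (?T 2 0)" "\<phi> (?T 0 1) = \<psi> (?T 0 1)" "\<phi> (?T 1 3) = \<psi> (?T 1 3)"
    using \<phi> \<psi> by (auto intro!: eq simp: is_S4_action_def E_def)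
  have conj: "\<phi> (?T i k) = \<psi> (?T i k)"
    if "distinct [i, j, k]" "\<phi> (?T i j) = \<psi> (?T i j)" "\<phi> (?T j k) = \<psi> (?T j k)" for i j k
  proof -
    have "?T i k = ?T i j \<circ> (?T j k \<circ> ?T i j)"
      using that(1) by (auto simp: fun_eq_iff Transposition.transpose_def)
    then show ?thesis using that by (simp add: comp bij_comp)
  qed
  have t: "\<phi> (?T 2 1) = \<psi> (?T 2 1)" "\<phi> (?T 0 3) = \<psi> (?T 0 3)"
    by (rule conj[of _ 0] conj[of _ 1]; simp add: gen)+
  have t': "\<phi> (?T 2 3) = \<psi> (?T 2 3)"
    by (rule conj[of _ 0]) (simp_all add: gen t)
  have transp: "\<phi> (?T i j) = \<psi> (?T i j)" for i j
  proof -
    have sw: "?T 1 2 = ?T 2 (1::4)" "?T 3 0 = ?T 0 (3::4)" "?T 3 2 = ?T 2 (3::4)" "?T 0 2 = ?T 2 (0::4)"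
      "?T 1 0 = ?T 0 (1::4)" "?T 3 1 = ?T 1 (3::4)"
      by (rule transpose_commute)+
    show ?thesis
      by (cases i rule: cases_4; cases j rule: cases_4; hypsubst;
          simp add: gen t t' sw id del: id_apply)
  qed
  have "\<sigma> permutes UNIV" using \<open>bij \<sigma>\<close> unfolding permutes_def bij_iff by simp
  then show ?thesis
  proof (rule permutes_induct)
    show "finite (UNIV :: 4 set)" by simp
    show "\<phi> id = \<psi> id" by (rule id)
    show "\<phi> (?T b c \<circ> p) = \<psi> (?T b c \<circ> p)" if "\<phi> p = \<psi> p" "p permutes UNIV" for b c p
      using that by (intro comp transp) (simp_all add: permutes_bij)
  qed
qed

theorem S4_act_ex1:
  "\<exists>!\<phi> :: (4 \<Rightarrow> 4) \<Rightarrow> 'f::field \<Rightarrow> 'f. is_S4_action \<phi> \<and> \<phi> \<in> extensional (carrier (BijGroup UNIV))"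
proof (rule ex_ex1I)
  fix \<phi> \<psi> :: "(4 \<Rightarrow> 4) \<Rightarrow> 'f \<Rightarrow> 'f"
  assume *: "is_S4_action \<phi> \<and> \<phi> \<in> extensional (carrier (BijGroup UNIV))"
    "is_S4_action \<psi> \<and> \<psi> \<in> extensional (carrier (BijGroup UNIV))"
  show "\<phi> = \<psi>"
    by (rule extensionalityI[of _ "carrier (BijGroup UNIV)"])
       (use * S4_action_unique[of \<phi> \<psi>] in \<open>auto simp: BijGroup_UNIV\<close>)
qed (rule ex_S4_action)

lemma is_S4_action_S4_act: "is_S4_action (S4_act :: _ \<Rightarrow> 'f::field \<Rightarrow> 'f)"
  using theI'[OF S4_act_ex1] unfolding S4_act_def by blast

end

theory Submission
  imports Defs
begin

text \<open>
  In a basis of eigenvectors of \<open>x\<^sub>k\<^sub>l\<close>, the relation \<open>[x\<^sub>k\<^sub>l, x\<^sub>k\<^sub>i] = 2 x\<^sub>k\<^sub>l - 2 x\<^sub>k\<^sub>i\<close> says that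
  \<open>x\<^sub>k\<^sub>i - x\<^sub>k\<^sub>l\<close> lowers the eigenvalue by 2, so its matrix is supported on one off-diagonal;
  likewise for \<open>x\<^sub>l\<^sub>i - x\<^sub>l\<^sub>k\<close> with the other off-diagonal. The vector \<open>\<Sum>n\<le>d. u n\<close> is an eigenvector of
  both \<open>x\<^sub>i\<^sub>k\<close> and \<open>x\<^sub>i\<^sub>l\<close> for \<open>-d\<close>, and reading this row by row gives the off-diagonal entries.
  The generators involving \<open>j\<close> follow from the linear relations, valid on the module,
  \<open>\<Sum>s. w r s x\<^sub>r\<^sub>s = 0\<close>, where \<open>w = pair_weight a\<close>, since \<open>\<alpha> = - w j k / w j l\<close>.
\<close>

section \<open>Coordinates, matrices and eigenvectors in an indexed basis\<close>

context vector_space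
begin

lemma indexed_basis_expand:
  assumes "indexed_basis scale d u"
  obtains c where "v = (\<Sum>p\<le>d. scale (c p) (u p))"
proof -
  have inj: "inj_on u {..d}" and "v \<in> span (u ` {..d})"
    using assms by (auto simp: indexed_basis_def)
  then obtain b where "v = (\<Sum>x\<in>u ` {..d}. scale (b x) x)"
    by (auto simp: span_finite)
  with that[of "b \<circ> u"] show thesis by (simp add: sum.reindex[OF inj] o_def)
qed

lemma indexed_basis_unique:
  assumes "indexed_basis scale d u" and eq: "(\<Sum>p\<le>d. scale (b p) (u p)) = (\<Sum>p\<le>d. scale (c p) (u p))"
    and "p \<le> d"
  shows "b p = c p"
proof -
  have inj: "inj_on u {..d}" and ind: "independent (u ` {..d})"
    using assms by (auto simp: indexed_basis_def)
  \<comment> \<open>Independence is stated for a set of vectors, so the coefficients are carried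
    from indices to vectors along the inverse of \<open>u\<close>.\<close>
  let ?f = "\<lambda>x. b (inv_into {..d} u x) - c (inv_into {..d} u x)"
  have "(\<Sum>x\<in>u ` {..d}. scale (?f x) x) = (\<Sum>p\<le>d. scale (b p - c p) (u p))"
    by (simp add: sum.reindex[OF inj] inv_into_f_f[OF inj])
  also have "\<dots> = 0" using eq by (simp add: scale_left_diff_distrib sum_subtractf)
  finally have "?f (u p) = 0"
    using \<open>p \<le> d\<close> by (intro independentD[OF ind]) auto
  then show ?thesis using \<open>p \<le> d\<close> by (simp add: inv_into_f_f[OF inj])
qed

lemma represents_ex:
  assumes "indexed_basis scale d u"
  obtains X where "represents scale d u T X"
proof -
  have "\<forall>q. \<exists>c. T (u q) = (\<Sum>p\<le>d. scale (c p) (u p))"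
  proof
    fix q
    obtain c where "T (u q) = (\<Sum>p\<le>d. scale (c p) (u p))"
      by (rule indexed_basis_expand[OF assms])
    then show "\<exists>c. T (u q) = (\<Sum>p\<le>d. scale (c p) (u p))" by blast
  qed
  then obtain c where "\<And>q. T (u q) = (\<Sum>p\<le>d. scale (c q p) (u p))" by metis
  with that[of "\<lambda>p q. c q p"] show thesis by (simp add: represents_def)
qed

text \<open>Compares coordinates on both sides of the eigenvector equation. With all
  \<open>c q\<close> equal to 1 this becomes a row sum, which is how the condition on the sum of the
  basis vectors enters.\<close>

lemma represents_eigenvector:
  assumes "indexed_basis scale d u" and lin: "Vector_Spaces.linear scale scale T"
    and X: "represents scale d u T X"
    and eig: "T (\<Sum>q\<le>d. scale (c q) (u q)) = scale \<mu> (\<Sum>q\<le>d. scale (c q) (u q))" and "p \<le> d"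
  shows "(\<Sum>q\<le>d. X p q * c q) = \<mu> * c p"
proof -
  interpret T: Vector_Spaces.linear scale scale T by fact
  have "(\<Sum>p\<le>d. scale (\<Sum>q\<le>d. X p q * c q) (u p)) = (\<Sum>q\<le>d. \<Sum>p\<le>d. scale (X p q * c q) (u p))"
    by (subst sum.swap) (simp add: scale_sum_left)
  also have "\<dots> = T (\<Sum>q\<le>d. scale (c q) (u q))"
    unfolding T.sum using X
    by (intro sum.cong) (simp_all add: represents_def T.scale scale_sum_right mult.commute)
  also have "\<dots> = (\<Sum>p\<le>d. scale (\<mu> * c p) (u p))"
    by (simp add: eig scale_sum_right)
  finally show ?thesis by (rule indexed_basis_unique[OF assms(1) _ \<open>p \<le> d\<close>])
qed

text \<open>Three summands, because the weighted relations among generators with a common first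
  index have three terms; the sign rule is the case of two zero coefficients.\<close>

lemma represents_combination:
  assumes "indexed_basis scale d u"
    and "represents scale d u T X" "represents scale d u A P" "represents scale d u B Q"
      "represents scale d u C R"
    and T: "\<And>v. T v = scale x (A v) + scale y (B v) + scale z (C v)" and "p \<le> d" "q \<le> d"
  shows "X p q = x * P p q + y * Q p q + z * R p q"
proof -
  have "(\<Sum>p\<le>d. scale (X p q) (u p)) = T (u q)"
    using assms by (simp add: represents_def)
  also have "\<dots> = (\<Sum>p\<le>d. scale (x * P p q + y * Q p q + z * R p q) (u p))"
    using assms by (simp add: represents_def scale_left_distrib sum.distrib scale_sum_right)
  finally show ?thesis by (rule indexed_basis_unique[OF assms(1) _ \<open>p \<le> d\<close>])
qed

text \<open>By \<open>shift\<close>, \<open>N (u q)\<close> satisfies the eigenvector equation of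
  \<open>K\<close> for \<open>\<kappa> q + c\<close>. Its coordinate at \<open>u p\<close> can then
  be nonzero only if \<open>\<kappa> p\<close> is that value.\<close>

lemma represents_weight_shift:
  assumes "indexed_basis scale d u" and "Vector_Spaces.linear scale scale N"
    and "Vector_Spaces.linear scale scale K"
    and K: "\<And>n. n \<le> d \<Longrightarrow> K (u n) = scale (\<kappa> n) (u n)"
    and shift: "\<And>v. K (N v) - N (K v) = scale c (N v)"
    and X: "represents scale d u N X" and "p \<le> d" "q \<le> d" "\<kappa> p \<noteq> \<kappa> q + c"
  shows "X p q = 0"
proof -
  interpret K: Vector_Spaces.linear scale scale K by fact
  interpret N: Vector_Spaces.linear scale scale N by fact
  have "(\<Sum>p\<le>d. scale (X p q * \<kappa> p) (u p)) = K (N (u q))"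
    using X \<open>q \<le> d\<close> by (simp add: represents_def K.sum K.scale K)
  also have "\<dots> = scale (\<kappa> q + c) (N (u q))"
    using shift[of "u q"] K[OF \<open>q \<le> d\<close>]
    by (simp add: N.scale scale_left_distrib diff_eq_eq)
  also have "\<dots> = (\<Sum>p\<le>d. scale ((\<kappa> q + c) * X p q) (u p))"
    using X \<open>q \<le> d\<close> by (simp add: represents_def scale_sum_right)
  finally have "X p q * \<kappa> p = (\<kappa> q + c) * X p q"
    by (rule indexed_basis_unique[OF assms(1) _ \<open>p \<le> d\<close>])
  then show ?thesis using \<open>\<kappa> p \<noteq> \<kappa> q + c\<close> by (simp add: mult.commute)
qed

text \<open>Applying \<open>T\<close> minus \<open>\<mu> s\<close> removes the term at
  \<open>s\<close> and multiplies the others by nonzero factors, which leaves a relation on the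
  smaller set. The \<open>y m\<close> may vanish, hence a conclusion about the terms and not the
  coefficients.\<close>

lemma eigenvectors_combination_eq_0:
  assumes lin: "Vector_Spaces.linear scale scale T" and "finite S" "inj_on \<mu> S"
    and "\<And>m. m \<in> S \<Longrightarrow> T (y m) = scale (\<mu> m) (y m)" and "(\<Sum>m\<in>S. scale (b m) (y m)) = 0" and "n \<in> S"
  shows "scale (b n) (y n) = 0"
proof -
  interpret T: Vector_Spaces.linear scale scale T by fact
  show ?thesis
    using assms(2-)
  proof (induction S arbitrary: b n rule: finite_induct)
    case (insert s S)
    have "(\<Sum>m\<in>insert s S. scale (b m * (\<mu> m - \<mu> s)) (y m)) =
        T (\<Sum>m\<in>insert s S. scale (b m) (y m)) - scale (\<mu> s) (\<Sum>m\<in>insert s S. scale (b m) (y m))"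
      unfolding T.sum scale_sum_right sum_subtractf[symmetric]
      by (rule sum.cong) (simp_all add: T.scale insert.prems(2) right_diff_distrib
            scale_left_diff_distrib mult.commute)
    also have "\<dots> = 0" by (simp only: insert.prems(3) T.zero) simp
    finally have "(\<Sum>m\<in>S. scale (b m * (\<mu> m - \<mu> s)) (y m)) = 0" using insert.hyps by simp
    note * = insert.IH[OF inj_on_subset[OF insert.prems(1) subset_insertI]
        insert.prems(2)[OF insertI2] this]
    have 0: "scale (b m) (y m) = 0" if "m \<in> S" for m
    proof -
      have "\<mu> m \<noteq> \<mu> s" using insert.prems(1) insert.hyps that by (auto simp: inj_on_def)
      then show ?thesis using *[OF _ that] by auto
    qed
    then have "(\<Sum>m\<in>S. scale (b m) (y m)) = 0" by (rule sum.neutral[OF ballI])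
    then have "scale (b s) (y s) = 0" using insert.prems(3) unfolding sum.insert[OF insert.hyps] by (simp only: add_0_right)
    then show ?case using 0 insert.prems(4) by fastforce
  qed simp
qed

text \<open>Otherwise the \<open>y m\<close> with \<open>m \<le> Suc d\<close> would be
  \<open>d + 2\<close> independent vectors, being eigenvectors for distinct eigenvalues, in a space
  spanned by \<open>d + 1\<close> vectors.\<close>

lemma eigenvector_sequence_vanishes:
  assumes "indexed_basis scale d u" and lin: "Vector_Spaces.linear scale scale T" and "inj \<mu>"
    and eig: "\<And>m::nat. T (y m) = scale (\<mu> m) (y m)"
  shows "\<exists>m. y m = 0"
proof (rule ccontr)
  assume "\<not> ?thesis"
  then have nz: "y m \<noteq> 0" for m by blast
  have inj: "inj y"
  proof (rule injI)
    fix m n assume "y m = y n"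
    then have "scale (\<mu> m) (y n) = scale (\<mu> n) (y n)"
      using eig[of m] eig[of n] by metis
    then have "\<mu> m = \<mu> n" using nz[of n] by (metis scale_right_imp_eq)
    then show "m = n" by (rule injD[OF \<open>inj \<mu>\<close>])
  qed
  have "independent (y ` {..Suc d})"
  proof (rule independent_if_scalars_zero)
    fix f x assume s: "(\<Sum>x\<in>y ` {..Suc d}. scale (f x) x) = 0" and "x \<in> y ` {..Suc d}"
    then obtain n where n: "x = y n" "n \<in> {..Suc d}" by auto
    have "(\<Sum>m\<in>{..Suc d}. scale (f (y m)) (y m)) = 0"
      using s unfolding sum.reindex[OF inj_on_subset[OF inj subset_UNIV]] o_def .
    then have "scale (f (y n)) (y n) = 0"
      by (rule eigenvectors_combination_eq_0[OF lin finite_atMost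
            inj_on_subset[OF \<open>inj \<mu>\<close> subset_UNIV] eig _ n(2)])
    then show "f x = 0" using n nz by simp
  qed simp
  moreover have "y ` {..Suc d} \<subseteq> span (u ` {..d})"
    using assms(1) by (simp add: indexed_basis_def)
  ultimately have "card (y ` {..Suc d}) \<le> card (u ` {..d})"
    by (rule independent_span_bound[OF finite_imageI[OF finite_atMost], THEN conjunct2])
  also have "\<dots> \<le> Suc d" using card_image_le[of "{..d}" u] by simp
  finally show False
    by (simp add: card_image[OF inj_on_subset[OF inj subset_UNIV]] del: image_subset_iff)
qed

end

section \<open>Eigenvalue shifts in a Lie module\<close>

context lie_module
begin

lemma act_diff_left: "act (x - y) v = act x v - act y v"
proof -
  interpret L: Vector_Spaces.linear sL sV "\<lambda>x. act x v" by (rule act_linear_left)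
  show ?thesis by (rule L.diff)
qed

lemma act_add_left: "act (x + y) v = act x v + act y v"
proof -
  interpret L: Vector_Spaces.linear sL sV "\<lambda>x. act x v" by (rule act_linear_left)
  show ?thesis by (rule L.add)
qed

lemma act_scale_left: "act (sL c x) v = sV c (act x v)"
proof -
  interpret L: Vector_Spaces.linear sL sV "\<lambda>x. act x v" by (rule act_linear_left)
  show ?thesis by (rule L.scale)
qed

lemma act_scale_right: "act x (sV c v) = sV c (act x v)"
proof -
  interpret L: Vector_Spaces.linear sV sV "act x" by (rule act_linear)
  show ?thesis by (rule L.scale)
qed

lemma act_zero_right: "act x 0 = 0"
proof -
  interpret L: Vector_Spaces.linear sV sV "act x" by (rule act_linear)
  show ?thesis by (rule L.zero)
qed

lemma act_shift_eigenvector: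
  assumes "br x y = sL c y" "act x v = sV \<mu> v"
  shows "act x (act y v) = sV (\<mu> + c) (act y v)"
proof -
  have "act x (act y v) = act (br x y) v + act y (act x v)" by (simp add: act_bracket)
  then show ?thesis
    by (simp only: assms act_scale_left act_scale_right vec.scale_left_distrib add.commute)
qed

text \<open>Makes \<open>x - y\<close> a ladder operator: with \<open>act_shift_eigenvector\<close>
  it lowers eigenvalues of \<open>x\<close> by 2.\<close>

lemma br_diff_eq:
  assumes "br x y = sL 2 x - sL 2 y"
  shows "br x (x - y) = sL (- 2) (x - y)"
proof -
  interpret L: Vector_Spaces.linear sL sL "br x" by (rule lie.bracket_linear_right)
  show ?thesis
    by (simp add: L.diff lie.bracket_self assms lie.scale_right_diff_distrib)
qed

end

text \<open>Iterating \<open>x - y\<close> on an eigenvector of \<open>x\<close> moves the eigenvalue down and ends in a common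
  eigenvector of \<open>x\<close> and \<open>y\<close>, whose eigenvalue must be at least the lowest one of \<open>y\<close>.\<close>

lemma lowest_eigenvector_transfer:
  fixes sL :: "'f::field_char_0 \<Rightarrow> 'l::ab_group_add \<Rightarrow> 'l" and sV :: "'f \<Rightarrow> 'v::ab_group_add \<Rightarrow> 'v"
  assumes "lie_module sL br sV act"
    and "indexed_basis sV d u" and br: "br x y = sL 2 x - sL 2 y"
    and low: "\<forall>m w. act y w = sV (\<nu> - 2 * of_nat (Suc m)) w \<longrightarrow> w = 0"
    and v: "act x v = sV (\<nu> - 2 * of_nat m) v" and "v \<noteq> 0"
  shows "m = 0 \<and> act y v = sV \<nu> v"
proof -
  interpret lie_module sL br sV act by fact
  have eig: "act x ((act (x - y) ^^ t) v) = sV (\<nu> - 2 * of_nat (m + t)) ((act (x - y) ^^ t) v)" for t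
  proof (induction t)
    case (Suc t)
    show ?case using act_shift_eigenvector[OF br_diff_eq[OF br] Suc] by (simp add: algebra_simps)
  qed (simp add: v)
  have "inj (\<lambda>t. \<nu> - 2 * of_nat (m + t) :: 'f)"
    by (rule injI) (simp flip: of_nat_add)
  with eig have ex: "\<exists>t. (act (x - y) ^^ t) v = 0"
    by (rule vec.eigenvector_sequence_vanishes[OF assms(2) act_linear, rotated])
  define t where "t = (LEAST t. (act (x - y) ^^ t) v = 0)"
  have 0: "(act (x - y) ^^ t) v = 0" unfolding t_def using ex by (rule LeastI_ex)
  then have "t \<noteq> 0" using \<open>v \<noteq> 0\<close> by (intro notI) simp
  then obtain s where s: "t = Suc s" by (cases t) auto
  define w where "w = (act (x - y) ^^ s) v"
  have "w \<noteq> 0" unfolding w_def by (rule not_less_Least) (simp add: s flip: t_def)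
  have "act (x - y) w = 0" using 0 by (simp add: s w_def)
  then have "act y w = act x w" by (simp add: act_diff_left)
  then have y: "act y w = sV (\<nu> - 2 * of_nat (m + s)) w" using eig[of s] by (simp add: w_def)
  \<comment> \<open>A positive \<open>m + s\<close> would make \<open>w\<close> an eigenvector of
    \<open>y\<close> of the kind excluded by \<open>low\<close>. So \<open>m\<close> and
    \<open>s\<close> are both 0, and \<open>w\<close> is \<open>v\<close> itself.\<close>
  have "m + s = 0"
  proof (cases "m + s")
    case (Suc r)
    then show ?thesis using low[rule_format, of w r] y \<open>w \<noteq> 0\<close> by (simp only:) blast
  qed
  then show ?thesis using y by (simp add: w_def)
qed


section \<open>Relatives as ratios of pair weights\<close>

text \<open>By \<open>permuted_ratio_comp\<close>, permuting the weights is a right action; the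
  inverse turns it into a left one. It agrees with \<open>\<phi>\<close> on the three prescribed
  transpositions, and these generate the group.\<close>

lemma S4_action_eq_permuted_ratio:
  fixes \<phi> :: "(4 \<Rightarrow> 4) \<Rightarrow> 'f::field \<Rightarrow> 'f"
  assumes \<phi>: "is_S4_action \<phi>" and "bij \<sigma>" "a \<noteq> 0" "a \<noteq> 1"
  shows "\<phi> \<sigma> a = permuted_ratio a (inv_into UNIV \<sigma>)"
proof -
  interpret act: group_action "BijGroup (UNIV :: 4 set)" "UNIV - {0, 1}" \<phi>
    using \<phi> by (simp add: is_S4_action_def)
  let ?T = Transposition.transpose
  \<comment> \<open>All parameters are quantified over because in a composition the left factor acts
    at the image of \<open>a\<close> under the right one.\<close>
  define P where "P \<tau> \<longleftrightarrow> bij \<tau> \<and> (\<forall>a\<in>UNIV - {0, 1}. \<phi> \<tau> a = permuted_ratio a (inv_into UNIV \<tau>))" for \<tau>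
  have comp: "P (\<tau> \<circ> \<upsilon>)" if "P \<tau>" "P \<upsilon>" for \<tau> \<upsilon>
  proof -
    have bij: "bij \<tau>" "bij \<upsilon>" using that by (simp_all add: P_def)
    have "\<phi> (\<tau> \<circ> \<upsilon>) b = permuted_ratio b (inv_into UNIV (\<tau> \<circ> \<upsilon>))" if b: "b \<noteq> 0" "b \<noteq> 1" for b
    proof -
      let ?c = "permuted_ratio b (inv_into UNIV \<upsilon>)"
      have c: "?c \<noteq> 0" "?c \<noteq> 1"
        using b bij by (simp_all add: permuted_ratio bij_imp_bij_inv)
      have "\<phi> (\<tau> \<circ> \<upsilon>) b = \<phi> \<tau> (\<phi> \<upsilon> b)"
        using act.composition_rule[of b \<tau> \<upsilon>] b bij by (simp add: BijGroup_UNIV)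
      also have "\<dots> = permuted_ratio ?c (inv_into UNIV \<tau>)"
        using \<open>P \<tau>\<close> \<open>P \<upsilon>\<close> b c by (simp add: P_def)
      also have "\<dots> = permuted_ratio b (inv_into UNIV \<upsilon> \<circ> inv_into UNIV \<tau>)"
        using b bij by (simp add: permuted_ratio_comp bij_imp_bij_inv)
      finally show ?thesis by (simp only: o_inv_distrib[OF bij])
    qed
    then show ?thesis using bij by (simp add: P_def bij_comp)
  qed
  have "\<phi> id b = b" if "b \<noteq> 0" "b \<noteq> 1" for b
    using fun_cong[OF act.id_eq_one, of b] that by (simp add: BijGroup_def id_def restrict_def)
  then have id: "P id"
    by (simp add: P_def permuted_ratio_def pair_weight_simps)
  have gen: "P (?T 2 0)" "P (?T 0 1)" "P (?T 1 3)"
    using \<phi>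
    by (simp_all add: P_def is_S4_action_def permuted_ratio_def pair_weight_simps
        Transposition.transpose_def divide_inverse)
  \<comment> \<open>The prescribed transpositions form the path 2, 0, 1, 3; conjugation yields those
    of the remaining pairs.\<close>
  have conj: "P (?T i k)" if "distinct [i, j, k]" "P (?T i j)" "P (?T j k)" for i j k
  proof -
    have "?T i k = ?T i j \<circ> (?T j k \<circ> ?T i j)"
      using that(1) by (auto simp: fun_eq_iff Transposition.transpose_def)
    then show ?thesis using that by (simp add: comp)
  qed
  have gen': "P (?T 2 1)" "P (?T 0 3)"
    by (rule conj[of _ 0] conj[of _ 1]; simp add: gen)+
  have gen'': "P (?T 2 3)"
    by (rule conj[of _ 0]) (simp_all add: gen gen')
  have transp: "P (?T i j)" for i j
  proof -
    have sw: "?T 1 2 = ?T 2 (1::4)" "?T 3 0 = ?T 0 (3::4)" "?T 3 2 = ?T 2 (3::4)" "?T 0 2 = ?T 2 (0::4)"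
      "?T 1 0 = ?T 0 (1::4)" "?T 3 1 = ?T 1 (3::4)"
      by (rule transpose_commute)+
    show ?thesis
      by (cases i rule: cases_4; cases j rule: cases_4; hypsubst;
          simp add: gen gen' gen'' sw id del: id_apply)
  qed
  have "\<sigma> permutes UNIV" using \<open>bij \<sigma>\<close> unfolding permutes_def bij_iff by simp
  then have "P \<sigma>"
  proof (rule permutes_induct)
    show "P (?T b c \<circ> p)" if "P p" for b c p by (rule comp[OF transp that])
  qed (simp_all only: finite id)
  then show ?thesis using assms by (simp add: P_def)
qed

lemma UNIV_eq_distinct_4:
  fixes i j k l :: 4
  assumes "distinct [i, j, k, l]"
  shows "UNIV = {i, j, k, l}"
proof -
  have "{i, j, k, l} = UNIV"
    by (rule card_subset_eq) (use assms in simp_all)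
  then show ?thesis by simp
qed

text \<open>The inverse of the permutation defining the relative sends 0, 1, 3 to \<open>j\<close>,
  \<open>k\<close>, \<open>l\<close>, the indices that occur in
  \<open>permuted_ratio\<close>.\<close>

lemma relative_eq:
  assumes "distinct [i, j, k, l]" "a \<noteq> 0" "a \<noteq> (1 :: 'f::field)"
  shows "relative i j k l a = - pair_weight a j k / pair_weight a j l"
proof -
  define \<sigma> :: "4 \<Rightarrow> 4" where
    "\<sigma> = (\<lambda>x. if x = i then 2 else if x = j then 0 else if x = k then 1 else 3)"
  have exhaust: "x = i \<or> x = j \<or> x = k \<or> x = l" for x
    using UNIV_eq_distinct_4[OF assms(1)] by auto
  have \<sigma>: "\<sigma> i = 2" "\<sigma> j = 0" "\<sigma> k = 1" "\<sigma> l = 3"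
    using assms(1) by (auto simp: \<sigma>_def)
  have "inj \<sigma>"
  proof (rule injI)
    fix x y assume "\<sigma> x = \<sigma> y"
    then show "x = y"
      using exhaust[of x] exhaust[of y] by (elim disjE) (simp_all add: \<sigma>)
  qed
  then have "bij \<sigma>" by (simp add: bij_def finite_UNIV_inj_surj)
  have "(THE \<sigma>. bij \<sigma> \<and> \<sigma> i = 2 \<and> \<sigma> j = 0 \<and> \<sigma> k = 1 \<and> \<sigma> l = 3) = \<sigma>"
  proof (rule the_equality)
    fix \<tau> :: "4 \<Rightarrow> 4" assume \<tau>: "bij \<tau> \<and> \<tau> i = 2 \<and> \<tau> j = 0 \<and> \<tau> k = 1 \<and> \<tau> l = 3"
    show "\<tau> = \<sigma>"
    proof
      show "\<tau> x = \<sigma> x" for x using exhaust[of x] \<tau> \<sigma> by (elim disjE) simp_all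
    qed
  qed (simp add: \<open>bij \<sigma>\<close> \<sigma>)
  then have "relative i j k l a = permuted_ratio a (inv_into UNIV \<sigma>)"
    using S4_action_eq_permuted_ratio[OF is_S4_action_S4_act \<open>bij \<sigma>\<close> assms(2,3)]
    by (simp add: relative_def)
  moreover have "inv_into UNIV \<sigma> 0 = j" "inv_into UNIV \<sigma> 1 = k" "inv_into UNIV \<sigma> 3 = l"
    using \<sigma> inv_f_f[OF \<open>inj \<sigma>\<close>] by metis+
  ultimately show ?thesis by (simp add: permuted_ratio_def)
qed

section \<open>Relations among generators with a common first index\<close>

text \<open>Relation (ii) at \<open>j\<close>, \<open>i\<close>, \<open>k\<close> after a sign
  change of the first generator; this is the form that \<open>br_diff_eq\<close> takes.\<close>

lemma tet_bracket_gen: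
  assumes "distinct [i, j, k]"
  shows "tet_bracket (tet_gen i j) (tet_gen i k) =
    tet_scale 2 (tet_gen i j) - tet_scale 2 (tet_gen i k :: 'f::field tet)"
proof -
  interpret lie_algebra "tet_scale :: 'f \<Rightarrow> _" tet_bracket by (rule lie_algebra_tet)
  interpret L: Vector_Spaces.linear tet_scale tet_scale "\<lambda>x::'f tet. tet_bracket x (tet_gen i k)"
    by (rule bracket_linear_left)
  have "tet_bracket (tet_gen j i) (tet_gen i k) =
      tet_scale 2 (tet_gen j i) + tet_scale 2 (tet_gen i k :: 'f tet)"
    using assms by transfer (rule tet_eq.rel_ii, auto)
  then show ?thesis
    by (simp add: tet_gen_swap[of i j] L.neg)
qed

text \<open>The characterization of \<open>EV a\<close> prescribes one ordering of each pair;
  antisymmetry of the generators gives the other.\<close>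

lemma EV_gen:
  assumes "a \<noteq> 0" "a \<noteq> (1::'f::field)" "i \<noteq> j"
  shows "EV a (tet_gen i j) = ev_half a i j - ev_half a j i"
proof -
  have EV: "is_EV a (EV a)" using assms by (intro is_EV_EV)
  then interpret lie_hom tet_scale tet_bracket sl2_scale sl2_bracket "EV a"
    by (simp add: is_EV_def)
  note base = EV[unfolded is_EV_def]
  have swap: "EV a (tet_gen j i) = - EV a (tet_gen i j)" for i j
    by (simp add: tet_gen_swap[of j i] neg)
  show ?thesis
    using assms(3) base swap[of 2 1] swap[of 3 2] swap[of 1 3] swap[of 3 0] swap[of 1 0] swap[of 2 0]
    by (cases i rule: cases_4; cases j rule: cases_4; simp add: ev_half_def)
qed

text \<open>For \<open>i = 0\<close> the multiples of \<open>sl2_x\<close>, \<open>sl2_y\<close> and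
  \<open>sl2_z\<close> cancel in the prescribed values. All four cases are checked in coordinates.
  Through these relations the parameter enters the matrices.\<close>

lemma EV_weighted_sum:
  assumes a: "a \<noteq> 0" "a \<noteq> (1::'f::field)"
  shows "(\<Sum>j\<in>UNIV. sl2_scale (pair_weight a i j) (EV a (tet_gen i j))) = 0"
proof -
  \<comment> \<open>Naming the inverses leaves polynomial identities modulo the rules
    \<open>abc\<close>.\<close>
  define b where "b = inverse a"
  define c where "c = inverse (1 - a)"
  have "1 - a \<noteq> 0" using a by simp
  then have abc: "a * b = 1" "a * c = c - 1"
    using a(1) by (simp_all add: b_def c_def field_simps)
  then have abc': "a * (b * t) = t" "a * (c * t) = c * t - t" for t
    by (metis mult.assoc mult_1 left_diff_distrib)+
  have 0: "sl2_scale 0 x = sl2_mk 0 0 0" for x :: "'f sl2"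
    by (cases x) simp
  have 4: "(UNIV :: 4 set) = {0, 1, 2, 3}" by (rule UNIV_eq_distinct_4) simp
  show ?thesis
    unfolding 4
    by (cases i rule: cases_4; hypsubst; simp add: EV_gen[OF a] pair_weight_simps 0 ev_half_mk
          sl2_eq_mk(1) flip: b_def c_def; simp add: algebra_simps abc abc')
qed

section \<open>The lowest component of a flag\<close>

text \<open>The definite description in \<open>flag_component\<close> has a value only if the
  components 0 of all decompositions \<open>[i, j]\<close> agree. Transferring lowest eigenvectors
  in both directions between \<open>j\<close> and \<open>k\<close> shows this.\<close>

lemma flag_component_0:
  fixes sV :: "'f::field_char_0 \<Rightarrow> 'v::ab_group_add \<Rightarrow> 'v"
  assumes mod: "lie_module tet_scale tet_bracket sV act" and basis: "indexed_basis sV d u"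
    and "k \<noteq> i"
    and low: "\<forall>m w. act (tet_gen i k) w = sV (- of_nat d - 2 * of_nat (Suc m)) w \<longrightarrow> w = 0"
    and "j \<noteq> i"
  shows "flag_component sV act d i 0 = decomposition_component sV act d i j 0"
proof -
  interpret lie_module tet_scale tet_bracket sV act by fact
  define D where "D j = decomposition_component sV act d i j 0" for j
  have D: "D j = D k" if "j \<noteq> i" for j
  proof (cases "j = k")
    case False
    then have br: "tet_bracket (tet_gen i j) (tet_gen i k) =
        tet_scale 2 (tet_gen i j) - tet_scale 2 (tet_gen i k :: 'f tet)"
      "tet_bracket (tet_gen i k) (tet_gen i j) =
        tet_scale 2 (tet_gen i k) - tet_scale 2 (tet_gen i j :: 'f tet)"
      using that \<open>k \<noteq> i\<close> by (intro tet_bracket_gen; auto)+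
    \<comment> \<open>The backward direction needs the bound for \<open>j\<close>. An eigenvector
      violating it would transfer to \<open>k\<close> with \<open>Suc m = 0\<close>.\<close>
    have low': "\<forall>m w. act (tet_gen i j) w = sV (- of_nat d - 2 * of_nat (Suc m)) w \<longrightarrow> w = 0"
    proof (intro allI impI, rule ccontr)
      fix m w assume "act (tet_gen i j) w = sV (- of_nat d - 2 * of_nat (Suc m)) w" "w \<noteq> 0"
      from lowest_eigenvector_transfer[OF mod basis br(1) low this] show False by simp
    qed
    show ?thesis
    proof (intro equalityI subsetI)
      fix v assume "v \<in> D j"
      then show "v \<in> D k"
        using lowest_eigenvector_transfer[OF mod basis br(1) low, where m = 0 and v = v]
        by (cases "v = 0") (auto simp: D_def decomposition_component_def act_zero_right)
    next
      fix v assume "v \<in> D k"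
      then show "v \<in> D j"
        using lowest_eigenvector_transfer[OF mod basis br(2) low', where m = 0 and v = v]
        by (cases "v = 0") (auto simp: D_def decomposition_component_def act_zero_right)
    qed
  qed simp
  have sum: "{\<Sum>m\<le>(0::nat). w m | w. \<forall>m\<le>0. w m \<in> decomposition_component sV act d i j m} = D j" for j
    by (auto simp: D_def)
  show ?thesis
    unfolding flag_component_def sum
    unfolding D_def[symmetric]
  proof (rule the_equality)
    show "\<forall>j'. j' \<noteq> i \<longrightarrow> D j = D j'" using D \<open>j \<noteq> i\<close> by metis
  qed (use \<open>j \<noteq> i\<close> in blast)
qed


section \<open>Matrices of the generators among \<open>i\<close>, \<open>k\<close>,
  \<open>l\<close>\<close>

lemma tet_basis_matrices:
  fixes sV :: "'f::field_char_0 \<Rightarrow> 'v::ab_group_add \<Rightarrow> 'v"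
  assumes mod: "lie_module tet_scale tet_bracket sV act"
    and u: "tet_basis sV act d i j k l u"
    and M: "\<And>r s. represents sV d u (act (tet_gen r s)) (M r s)"
    and "p \<le> d" "q \<le> d"
  shows "M s r p q = - M r s p q"
    and "M k l p q = (if p = q then 2 * of_nat p - of_nat d else 0)"
    and "M k i p q = (if p = q then 2 * of_nat p - of_nat d else
      if q = Suc p then 2 * (of_nat d - of_nat p) else 0)"
    and "M l i p q = (if p = q then of_nat d - 2 * of_nat p else
      if p = Suc q then 2 * of_nat p else 0)"
proof -
  interpret lie_module tet_scale tet_bracket sV act by fact
  have dist: "distinct [i, j, k, l]" and basis: "indexed_basis sV d u"
    and "\<And>n. n \<le> d \<Longrightarrow> u n \<in> decomposition_component sV act d k l n"
    and flag: "(\<Sum>n\<le>d. u n) \<in> flag_component sV act d i 0"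
    using u by (auto simp: tet_basis_def)
  then have kl: "act (tet_gen k l) (u n) = sV (2 * of_nat n - of_nat d) (u n)" if "n \<le> d" for n
    using that by (simp add: decomposition_component_def)
  have neg: "act (- x) v = sV (- 1) (act x v)" for x v
    using act_diff_left[of 0 x v] act_diff_left[of x x v] by simp
  have lk: "act (tet_gen l k) (u n) = sV (of_nat d - 2 * of_nat n) (u n)" if "n \<le> d" for n
    using kl[OF that] by (simp add: tet_gen_swap[of l k] neg)
  note combine = vec.represents_combination[OF basis]
  have swap: "M s r p q = - M r s p q" if "p \<le> d" "q \<le> d" for r s p q
    using combine[OF M M M M, where x = "- 1" and y = 0 and z = 0, OF _ that, of s r r s r s r s]
    by (simp add: tet_gen_swap[of s r] neg)
  then show "M s r p q = - M r s p q" using \<open>p \<le> d\<close> \<open>q \<le> d\<close> .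
  have Mkl: "M k l p q = (if p = q then 2 * of_nat p - of_nat d else 0)" if "p \<le> d" "q \<le> d" for p q
  proof (rule vec.indexed_basis_unique[OF basis _ \<open>p \<le> d\<close>])
    have "(\<Sum>p\<le>d. sV (M k l p q) (u p)) = sV (2 * of_nat q - of_nat d) (u q)"
      using M[of k l] kl[OF \<open>q \<le> d\<close>] \<open>q \<le> d\<close> by (simp add: represents_def)
    also have "\<dots> = (\<Sum>p\<le>d. if p = q then sV (2 * of_nat p - of_nat d) (u p) else 0)"
      using \<open>q \<le> d\<close> by simp
    also have "\<dots> = (\<Sum>p\<le>d. sV (if p = q then 2 * of_nat p - of_nat d else 0) (u p))"
      by (rule sum.cong) simp_all
    finally show "(\<Sum>p\<le>d. sV (M k l p q) (u p)) =
      (\<Sum>p\<le>d. sV (if p = q then 2 * of_nat p - of_nat d else 0) (u p))" .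
  qed
  then show "M k l p q = (if p = q then 2 * of_nat p - of_nat d else 0)"
    using \<open>p \<le> d\<close> \<open>q \<le> d\<close> .
  have diff: "represents sV d u (act (tet_gen r s - tet_gen r t)) (\<lambda>p q. M r s p q - M r t p q)" for r s t
    using M[of r s] M[of r t]
    by (simp add: represents_def act_diff_left vec.scale_left_diff_distrib sum_subtractf)
  have shift: "act (tet_gen r s) (act (tet_gen r s - tet_gen r t) v) -
      act (tet_gen r s - tet_gen r t) (act (tet_gen r s) v) = sV (- 2) (act (tet_gen r s - tet_gen r t) v)"
    if "distinct [r, s, t]" for r s t v
    by (simp only: act_bracket[symmetric] br_diff_eq[OF tet_bracket_gen[OF that]] act_scale_left)
  \<comment> \<open>The eigenvalue \<open>2 * p - d\<close> grows with the index, so lowering it by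
    2 lowers the index by one: only \<open>q = Suc p\<close> survives, in characteristic 0.\<close>
  have ki0: "M k i p q = M k l p q" if "p \<le> d" "q \<le> d" "q \<noteq> Suc p" for p q
  proof -
    have "of_nat (2 * q) \<noteq> (of_nat (2 * Suc p) :: 'f)"
      using \<open>q \<noteq> Suc p\<close> unfolding of_nat_eq_iff by simp
    then have "2 * of_nat p - of_nat d \<noteq> 2 * of_nat q - of_nat d + (- 2 :: 'f)"
      by (auto simp: algebra_simps)
    then have "M k l p q - M k i p q = 0"
      by (rule vec.represents_weight_shift[OF basis act_linear act_linear kl shift diff that(1,2), rotated 2])
         (use dist in auto)
    then show ?thesis by simp
  qed
  \<comment> \<open>For \<open>x\<^sub>l\<^sub>k\<close> the eigenvalues decrease with the index, so
    the same drop by 2 raises the index.\<close>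
  have li0: "M l i p q = M l k p q" if "p \<le> d" "q \<le> d" "p \<noteq> Suc q" for p q
  proof -
    have "of_nat (2 * p) \<noteq> (of_nat (2 * Suc q) :: 'f)"
      using \<open>p \<noteq> Suc q\<close> unfolding of_nat_eq_iff by simp
    then have "of_nat d - 2 * of_nat p \<noteq> of_nat d - 2 * of_nat q + (- 2 :: 'f)"
      by (auto simp: algebra_simps)
    then have "M l k p q - M l i p q = 0"
      by (rule vec.represents_weight_shift[OF basis act_linear act_linear lk shift diff that(1,2), rotated 2])
         (use dist in auto)
    then show ?thesis by simp
  qed
  \<comment> \<open>Needed before the flag condition can be used. By \<open>ki0\<close> the matrix
    of \<open>x\<^sub>i\<^sub>k\<close> is upper triangular with diagonal \<open>d - 2 * p\<close>,
    never below \<open>-d\<close>; the coordinates of \<open>w\<close> vanish by back substitution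
    from the last one.\<close>
  have low: "\<forall>m w. act (tet_gen i k) w = sV (- of_nat d - 2 * of_nat (Suc m)) w \<longrightarrow> w = 0"
  proof (intro allI impI)
    fix m w assume eig: "act (tet_gen i k) w = sV (- of_nat d - 2 * of_nat (Suc m)) w"
    obtain c where w: "w = (\<Sum>p\<le>d. sV (c p) (u p))" by (rule vec.indexed_basis_expand[OF basis])
    have "c p = 0" if "p \<le> d" for p
      using that
    proof (induction "d - p" arbitrary: p rule: less_induct)
      case less
      have "(\<Sum>q\<le>d. M i k p q * c q) = (- of_nat d - 2 * of_nat (Suc m)) * c p"
        using eig unfolding w by (rule vec.represents_eigenvector[OF basis act_linear M _ less.prems])
      moreover have "(\<Sum>q\<le>d. M i k p q * c q) = (\<Sum>q\<le>d. if q = p then (of_nat d - 2 * of_nat p) * c p else 0)"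
      proof (rule sum.cong)
        fix q assume "q \<in> {..d}"
        then have "q \<le> d" by simp
        have Mik: "M i k p q = - M k i p q" using swap less.prems \<open>q \<le> d\<close> .
        show "M i k p q * c q = (if q = p then (of_nat d - 2 * of_nat p) * c p else 0)"
        proof (cases "p < q")
          case True
          then have "c q = 0" using \<open>q \<le> d\<close> by (intro less.hyps) auto
          then show ?thesis using True by simp
        next
          case False
          then show ?thesis using \<open>q \<le> d\<close> less.prems by (simp add: Mik ki0 Mkl left_diff_distrib)
        qed
      qed simp
      ultimately have "(of_nat d - 2 * of_nat p) * c p = (- of_nat d - 2 * of_nat (Suc m)) * c p"
        using less.prems by simp
      \<comment> \<open>The factor is the diagonal entry minus the supposed eigenvalue, a positive
        integer.\<close>
      then have "of_nat (2 * (d - p + Suc m)) * c p = 0"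
        using less.prems by (simp add: of_nat_diff algebra_simps)
      then show "c p = 0" unfolding mult_eq_0_iff of_nat_eq_0_iff by simp
    qed
    then show "w = 0" by (simp add: w)
  qed
  have comp: "(\<Sum>n\<le>d. u n) \<in> decomposition_component sV act d i r 0" if "r \<noteq> i" for r
    using flag flag_component_0[OF mod basis _ low that] dist by auto
  have row: "(\<Sum>q\<le>d. M r i p q) = of_nat d" if "r \<noteq> i" "p \<le> d" for r p
  proof -
    \<comment> \<open>The factors 1 are the coordinates of the sum of the basis vectors.\<close>
    have "(\<Sum>q\<le>d. M i r p q * 1) = - of_nat d * 1"
      using comp[OF \<open>r \<noteq> i\<close>] that(2)
      by (intro vec.represents_eigenvector[OF basis act_linear M])
         (simp_all add: decomposition_component_def)
    then show ?thesis using swap[of p _ r i] that(2) by (simp add: sum_negf)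
  qed
  \<comment> \<open>Row \<open>p\<close> consists of this entry and the diagonal
    \<open>2 * p - d\<close>, and sums to \<open>d\<close>. In the table the entry stands at
    \<open>n = Suc p\<close>, hence \<open>2 * d - 2 * n + 2\<close> there.\<close>
  have ki: "M k i p (Suc p) = 2 * (of_nat d - of_nat p)" if "Suc p \<le> d" for p
  proof -
    have "(\<Sum>q\<le>d. M k i p q) = (\<Sum>q\<in>{p, Suc p}. M k i p q)"
      by (rule sum.mono_neutral_right) (use that in \<open>auto simp: ki0 Mkl\<close>)
    moreover have "(\<Sum>q\<le>d. M k i p q) = of_nat d" using that dist by (intro row) auto
    ultimately show ?thesis using that by (simp add: ki0 Mkl algebra_simps)
  qed
  show "M k i p q = (if p = q then 2 * of_nat p - of_nat d else
      if q = Suc p then 2 * (of_nat d - of_nat p) else 0)"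
    using \<open>p \<le> d\<close> \<open>q \<le> d\<close> ki[of p] by (simp add: ki0 Mkl)
  have li: "M l i (Suc q) q = 2 * of_nat (Suc q)" if "Suc q \<le> d" for q
  proof -
    have "(\<Sum>p\<le>d. M l i (Suc q) p) = (\<Sum>p\<in>{Suc q, q}. M l i (Suc q) p)"
      by (rule sum.mono_neutral_right) (use that in \<open>auto simp: li0 Mkl swap[of _ _ l k]\<close>)
    moreover have "(\<Sum>p\<le>d. M l i (Suc q) p) = of_nat d" using that dist by (intro row) auto
    ultimately show ?thesis using that by (simp add: li0 Mkl swap[of _ _ l k] algebra_simps)
  qed
  show "M l i p q = (if p = q then of_nat d - 2 * of_nat p else
      if p = Suc q then 2 * of_nat p else 0)"
    using \<open>p \<le> d\<close> \<open>q \<le> d\<close> li[of q] by (auto simp: li0 Mkl swap[of _ _ l k])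
qed


section \<open>Generators involving \<open>j\<close> and the table of entries\<close>

lemma pair_weight_matrices_sum:
  fixes sV :: "'f::field \<Rightarrow> 'v::ab_group_add \<Rightarrow> 'v"
  assumes a: "a \<noteq> 0" "a \<noteq> 1"
    and mod: "lie_module sl2_scale sl2_bracket sV \<rho>" and basis: "indexed_basis sV d u"
    and M: "\<And>r s. represents sV d u (pullback (EV a) \<rho> (tet_gen r s)) (M r s)"
    and dist: "distinct [i, j, k, l]" and "p \<le> d" "q \<le> d"
  shows "pair_weight a i j * M i j p q + pair_weight a i k * M i k p q
    + pair_weight a i l * M i l p q = 0"
proof -
  interpret lie_module sl2_scale sl2_bracket sV \<rho> by fact
  let ?g = "\<lambda>r. EV a (tet_gen i r)"
  have "sl2_scale (pair_weight a i j) (?g j) + sl2_scale (pair_weight a i k) (?g k)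
      + sl2_scale (pair_weight a i l) (?g l) = 0"
    using EV_weighted_sum[OF a, of i] dist
    unfolding UNIV_eq_distinct_4[OF dist] by (simp add: pair_weight_simps(1) add.assoc)
  \<comment> \<open>Zero is written as a multiple so that linearity in the algebra element evaluates
    its action to 0.\<close>
  then have "\<rho> (sl2_scale (pair_weight a i j) (?g j) + sl2_scale (pair_weight a i k) (?g k)
      + sl2_scale (pair_weight a i l) (?g l)) v = \<rho> (sl2_scale 0 (?g i)) v" for v
    by simp
  then have "0 = pair_weight a i j * M i j p q + pair_weight a i k * M i k p q
      + pair_weight a i l * M i l p q"
    by (intro vec.represents_combination[OF basis _ M M M _ \<open>p \<le> d\<close> \<open>q \<le> d\<close>,
          where T = "\<lambda>_. 0" and X = "\<lambda>_ _. 0"])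
       (simp_all add: represents_def pullback_def act_add_left act_scale_left del: lie.scale_zero_left)
  then show ?thesis by simp
qed

text \<open>Off-diagonal entries are indexed by the larger of row and column, hence
  \<open>lo p\<close> but \<open>up q\<close>.\<close>

lemma tridiagonal_has_entriesI:
  fixes X :: "nat \<Rightarrow> nat \<Rightarrow> 'f::field"
  assumes "\<And>p q. p \<le> d \<Longrightarrow> q \<le> d \<Longrightarrow> X p q =
      (if p = q then di p else if p = Suc q then lo p else if q = Suc p then up q else 0)"
  shows "tridiagonal d X \<and> has_entries d X lo di up"
proof -
  have "X n (n - 1) = lo n" "X (n - 1) n = up n" if "n \<in> {1..d}" for n
    using that assms[of n "n - 1"] assms[of "n - 1" n] by auto
  then show ?thesis by (simp add: tridiagonal_def has_entries_def assms)
qed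

theorem theorem10p7:
  fixes a \<alpha> :: "'f::{alg_closed_field, field_char_0}"
    and sV :: "'f \<Rightarrow> 'v::ab_group_add \<Rightarrow> 'v"
    and \<rho> :: "'f sl2 \<Rightarrow> 'v \<Rightarrow> 'v"
    and act :: "'f tet \<Rightarrow> 'v \<Rightarrow> 'v"
    and d :: nat
    and i j k l r s :: 4
    and u :: "nat \<Rightarrow> 'v"
    and X :: "nat \<Rightarrow> nat \<Rightarrow> 'f"
  assumes "d \<ge> 1" and "a \<noteq> 0" and "a \<noteq> 1"
    and "irreducible_lie_module sl2_scale sl2_bracket sV \<rho>"
    and "vector_space.dim sV (UNIV :: 'v set) = d + 1"
    and "act = pullback (EV a) \<rho>"
    and "distinct [i, j, k, l]"
    and "\<alpha> = relative i j k l a"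
    and "r \<noteq> s"
    and "tet_basis sV act d i j k l u"
    and "represents sV d u (act (tet_gen r s)) X"
  shows "tridiagonal d X \<and>
      ((r, s) = (l, k) \<longrightarrow> has_entries d X
        (\<lambda>n. 0)
        (\<lambda>n. of_nat d - 2 * of_nat n)
        (\<lambda>n. 0)) \<and>
      ((r, s) = (k, l) \<longrightarrow> has_entries d X
        (\<lambda>n. 0)
        (\<lambda>n. 2 * of_nat n - of_nat d)
        (\<lambda>n. 0)) \<and>
      ((r, s) = (k, i) \<longrightarrow> has_entries d X
        (\<lambda>n. 0)
        (\<lambda>n. 2 * of_nat n - of_nat d)
        (\<lambda>n. 2 * of_nat d - 2 * of_nat n + 2)) \<and>
      ((r, s) = (i, k) \<longrightarrow> has_entries d X
        (\<lambda>n. 0)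
        (\<lambda>n. of_nat d - 2 * of_nat n)
        (\<lambda>n. 2 * of_nat n - 2 * of_nat d - 2)) \<and>
      ((r, s) = (i, l) \<longrightarrow> has_entries d X
        (\<lambda>n. - 2 * of_nat n)
        (\<lambda>n. 2 * of_nat n - of_nat d)
        (\<lambda>n. 0)) \<and>
      ((r, s) = (l, i) \<longrightarrow> has_entries d X
        (\<lambda>n. 2 * of_nat n)
        (\<lambda>n. of_nat d - 2 * of_nat n)
        (\<lambda>n. 0)) \<and>
      ((r, s) = (l, j) \<longrightarrow> has_entries d X
        (\<lambda>n. 2 * \<alpha> * of_nat n)
        (\<lambda>n. of_nat d - 2 * of_nat n)
        (\<lambda>n. 0)) \<and>
      ((r, s) = (j, l) \<longrightarrow> has_entries d X
        (\<lambda>n. - 2 * \<alpha> * of_nat n)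
        (\<lambda>n. 2 * of_nat n - of_nat d)
        (\<lambda>n. 0)) \<and>
      ((r, s) = (j, k) \<longrightarrow> has_entries d X
        (\<lambda>n. 0)
        (\<lambda>n. of_nat d - 2 * of_nat n)
        (\<lambda>n. 2 * (of_nat n - of_nat d - 1) * inverse \<alpha>)) \<and>
      ((r, s) = (k, j) \<longrightarrow> has_entries d X
        (\<lambda>n. 0)
        (\<lambda>n. 2 * of_nat n - of_nat d)
        (\<lambda>n. 2 * (of_nat d - of_nat n + 1) * inverse \<alpha>)) \<and>
      ((r, s) = (j, i) \<longrightarrow> has_entries d X
        (\<lambda>n. 2 * \<alpha> * of_nat n * inverse (\<alpha> - 1))
        (\<lambda>n. (of_nat d - 2 * of_nat n) * (\<alpha> + 1) * inverse (\<alpha> - 1))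
        (\<lambda>n. 2 * (of_nat d - of_nat n + 1) * inverse (1 - \<alpha>))) \<and>
      ((r, s) = (i, j) \<longrightarrow> has_entries d X
        (\<lambda>n. 2 * \<alpha> * of_nat n * inverse (1 - \<alpha>))
        (\<lambda>n. (of_nat d - 2 * of_nat n) * (\<alpha> + 1) * inverse (1 - \<alpha>))
        (\<lambda>n. 2 * (of_nat d - of_nat n + 1) * inverse (\<alpha> - 1)))"
proof -
  note a = \<open>a \<noteq> 0\<close> \<open>a \<noteq> 1\<close> and dist = \<open>distinct [i, j, k, l]\<close>
    and u = \<open>tet_basis sV act d i j k l u\<close>
  have basis: "indexed_basis sV d u" using u by (simp add: tet_basis_def)
  have mod: "lie_module sl2_scale sl2_bracket sV \<rho>"
    using assms(4) by (simp add: irreducible_lie_module_def)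
  then have tet_mod: "lie_module tet_scale tet_bracket sV act"
    using a \<open>act = _\<close> by (simp add: lie_module_evaluation)
  interpret lie_module tet_scale tet_bracket sV act by fact
  \<comment> \<open>A matrix is constrained only at indices up to \<open>d\<close>, so
    \<open>X\<close> itself is made the choice for the pair \<open>r\<close>,
    \<open>s\<close>.\<close>
  have "\<exists>Y. represents sV d u (act (tet_gen r' s')) Y \<and> (r' = r \<and> s' = s \<longrightarrow> Y = X)" for r' s'
    using assms(11) vec.represents_ex[OF basis, of "act (tet_gen r' s')"] by metis
  then obtain M where M: "\<And>r s. represents sV d u (act (tet_gen r s)) (M r s)" and X: "M r s = X"
    by metis
  note tet = tet_basis_matrices[OF tet_mod u M]
  have neq: "i \<noteq> j" "i \<noteq> k" "i \<noteq> l" "j \<noteq> k" "j \<noteq> l" "k \<noteq> l"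
      "j \<noteq> i" "k \<noteq> i" "l \<noteq> i" "k \<noteq> j" "l \<noteq> j" "l \<noteq> k"
    using dist by auto
  define w where "w = pair_weight a"
  have w: "w j l \<noteq> 0" "w j k \<noteq> 0" "w j i \<noteq> 0"
    unfolding w_def using dist by (intro pair_weight_nz[OF a]; auto)+
  \<comment> \<open>Complementary pairs have equal weight, so all weights reduce to those at
    \<open>j\<close>. These are \<open>- \<alpha>\<close>, \<open>1\<close> and
    \<open>\<alpha> - 1\<close> times \<open>w j l\<close>, for \<open>k\<close>, \<open>l\<close>
    and \<open>i\<close>.\<close>
  have w_compl: "w i k = w j l" "w i l = w j k" "w k l = w j i"
    unfolding w_def using dist by (intro pair_weight_compl; auto)+
  have w_sym: "w x y = w y x" for x y
    unfolding w_def by (rule pair_weight_sym)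
  have w_eq: "w k i = w j l" "w l j = w j l" "w l i = w j k" "w k j = w j k"
      "w i j = w j i" "w l k = w j i"
    using w_compl w_sym by metis+
  have w_sum: "w j i = - w j k - w j l"
    using pair_weight_sum[of j i k l a] by (simp add: neq w_def algebra_simps eq_neg_iff_add_eq_0)
  have \<alpha>: "w j k = - \<alpha> * w j l"
    using \<open>\<alpha> = _\<close> w(1) by (simp add: relative_eq[OF dist a] w_def)
  have \<alpha>01: "\<alpha> \<noteq> 0" "\<alpha> \<noteq> 1"
    using w \<alpha> w_sum by auto
  have w_ji: "w j i = (\<alpha> - 1) * w j l"
    using w_sum \<alpha> by (simp add: algebra_simps)
  have rel: "w r s * M r s p q + w r t * M r t p q + w r v * M r v p q = 0"
    if "distinct [r, s, t, v]" "p \<le> d" "q \<le> d" for r s t v p q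
    using pair_weight_matrices_sum[OF a mod basis M[unfolded \<open>act = _\<close>] that] by (simp add: w_def)
  \<comment> \<open>The weighted relation at \<open>k\<close>, divided by \<open>w j l\<close>;
    \<open>lj\<close> and \<open>ij\<close> come from those at \<open>l\<close> and
    \<open>i\<close>.\<close>
  have kj: "M k j p q = (M k i p q - (1 - \<alpha>) * M k l p q) / \<alpha>" if "p \<le> d" "q \<le> d" for p q
  proof -
    have "w j l * (M k i p q - \<alpha> * M k j p q + (\<alpha> - 1) * M k l p q) = 0"
      using rel[of k i j l p q] that neq unfolding w_eq w_compl w_ji \<alpha> by (simp add: algebra_simps)
    then show ?thesis using w(1) \<alpha>01 unfolding mult_eq_0_iff by (simp add: field_simps)
  qed
  have lj: "M l j p q = \<alpha> * M l i p q - (1 - \<alpha>) * M k l p q" if "p \<le> d" "q \<le> d" for p q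
  proof -
    have "w j l * (- \<alpha> * M l i p q + M l j p q - (\<alpha> - 1) * M k l p q) = 0"
      using rel[of l i j k p q] that neq tet(1)[OF that, of l k]
      unfolding w_eq w_compl w_ji \<alpha> by (simp add: algebra_simps)
    then show ?thesis using w(1) unfolding mult_eq_0_iff by (simp add: algebra_simps)
  qed
  have ij: "M i j p q = (M k i p q - \<alpha> * M l i p q) / (\<alpha> - 1)" if "p \<le> d" "q \<le> d" for p q
  proof -
    have "w j l * ((\<alpha> - 1) * M i j p q - M k i p q + \<alpha> * M l i p q) = 0"
      using rel[of i j k l p q] that neq tet(1)[OF that, of i k] tet(1)[OF that, of i l]
      unfolding w_eq w_compl w_ji \<alpha> by (simp add: algebra_simps)
    then show ?thesis using w(1) \<alpha>01 unfolding mult_eq_0_iff by (simp add: field_simps)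
  qed
  \<comment> \<open>One ordering of each of the six pairs; \<open>tet(1)\<close> supplies the
    other.\<close>
  note formulas = kj lj ij tet(2-4)
  have lk_entries: "tridiagonal d (M l k) \<and> has_entries d (M l k)
      (\<lambda>n. 0)
      (\<lambda>n. of_nat d - 2 * of_nat n)
      (\<lambda>n. 0)"
    by (rule tridiagonal_has_entriesI) (auto simp: tet(1)[of _ _ l k] formulas \<alpha>01 divide_simps algebra_simps)
  have kl_entries: "tridiagonal d (M k l) \<and> has_entries d (M k l)
      (\<lambda>n. 0)
      (\<lambda>n. 2 * of_nat n - of_nat d)
      (\<lambda>n. 0)"
    by (rule tridiagonal_has_entriesI) (auto simp: formulas \<alpha>01 divide_simps algebra_simps)
  have ki_entries: "tridiagonal d (M k i) \<and> has_entries d (M k i)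
      (\<lambda>n. 0)
      (\<lambda>n. 2 * of_nat n - of_nat d)
      (\<lambda>n. 2 * of_nat d - 2 * of_nat n + 2)"
    by (rule tridiagonal_has_entriesI) (auto simp: formulas \<alpha>01 divide_simps algebra_simps)
  have ik_entries: "tridiagonal d (M i k) \<and> has_entries d (M i k)
      (\<lambda>n. 0)
      (\<lambda>n. of_nat d - 2 * of_nat n)
      (\<lambda>n. 2 * of_nat n - 2 * of_nat d - 2)"
    by (rule tridiagonal_has_entriesI) (auto simp: tet(1)[of _ _ i k] formulas algebra_simps)
  have il_entries: "tridiagonal d (M i l) \<and> has_entries d (M i l)
      (\<lambda>n. - 2 * of_nat n)
      (\<lambda>n. 2 * of_nat n - of_nat d)
      (\<lambda>n. 0)"
    by (rule tridiagonal_has_entriesI) (auto simp: tet(1)[of _ _ i l] formulas \<alpha>01 divide_simps algebra_simps)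
  have li_entries: "tridiagonal d (M l i) \<and> has_entries d (M l i)
      (\<lambda>n. 2 * of_nat n)
      (\<lambda>n. of_nat d - 2 * of_nat n)
      (\<lambda>n. 0)"
    by (rule tridiagonal_has_entriesI) (auto simp: formulas \<alpha>01 divide_simps algebra_simps)
  have lj_entries: "tridiagonal d (M l j) \<and> has_entries d (M l j)
      (\<lambda>n. 2 * \<alpha> * of_nat n)
      (\<lambda>n. of_nat d - 2 * of_nat n)
      (\<lambda>n. 0)"
    by (rule tridiagonal_has_entriesI) (auto simp: formulas \<alpha>01 divide_simps algebra_simps)
  have jl_entries: "tridiagonal d (M j l) \<and> has_entries d (M j l)
      (\<lambda>n. - 2 * \<alpha> * of_nat n)
      (\<lambda>n. 2 * of_nat n - of_nat d)
      (\<lambda>n. 0)"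
    by (rule tridiagonal_has_entriesI) (auto simp: tet(1)[of _ _ j l] formulas \<alpha>01 divide_simps algebra_simps)
  have jk_entries: "tridiagonal d (M j k) \<and> has_entries d (M j k)
      (\<lambda>n. 0)
      (\<lambda>n. of_nat d - 2 * of_nat n)
      (\<lambda>n. 2 * (of_nat n - of_nat d - 1) * inverse \<alpha>)"
    by (rule tridiagonal_has_entriesI) (auto simp: tet(1)[of _ _ j k] formulas \<alpha>01 divide_simps algebra_simps)
  have kj_entries: "tridiagonal d (M k j) \<and> has_entries d (M k j)
      (\<lambda>n. 0)
      (\<lambda>n. 2 * of_nat n - of_nat d)
      (\<lambda>n. 2 * (of_nat d - of_nat n + 1) * inverse \<alpha>)"
    by (rule tridiagonal_has_entriesI) (auto simp: formulas \<alpha>01 divide_simps algebra_simps)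
  \<comment> \<open>The table uses both denominators; the last two cases are computed with
    one.\<close>
  have inverse_swap: "inverse (1 - \<alpha>) = - inverse (\<alpha> - 1)"
    by (metis inverse_minus_eq minus_diff_eq)
  have ji_entries: "tridiagonal d (M j i) \<and> has_entries d (M j i)
      (\<lambda>n. 2 * \<alpha> * of_nat n * inverse (\<alpha> - 1))
      (\<lambda>n. (of_nat d - 2 * of_nat n) * (\<alpha> + 1) * inverse (\<alpha> - 1))
      (\<lambda>n. 2 * (of_nat d - of_nat n + 1) * inverse (1 - \<alpha>))"
    by (rule tridiagonal_has_entriesI) (auto simp: tet(1)[of _ _ j i] formulas \<alpha>01 divide_inverse inverse_swap algebra_simps)
  have ij_entries: "tridiagonal d (M i j) \<and> has_entries d (M i j)
      (\<lambda>n. 2 * \<alpha> * of_nat n * inverse (1 - \<alpha>))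
      (\<lambda>n. (of_nat d - 2 * of_nat n) * (\<alpha> + 1) * inverse (1 - \<alpha>))
      (\<lambda>n. 2 * (of_nat d - of_nat n + 1) * inverse (\<alpha> - 1))"
    by (rule tridiagonal_has_entriesI) (auto simp: formulas \<alpha>01 divide_inverse inverse_swap algebra_simps)
  have "r \<in> {i, j, k, l}" "s \<in> {i, j, k, l}" using UNIV_eq_distinct_4[OF dist] by auto
  then show ?thesis
    unfolding X[symmetric] using \<open>r \<noteq> s\<close>
    by (elim insertE emptyE; simp only: prod.inject simp_thms neq
        kl_entries lk_entries ki_entries ik_entries li_entries il_entries
        lj_entries jl_entries kj_entries jk_entries ij_entries ji_entries)
qed

end
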